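(* Let $q$ be a power of an odd prime, $A=\mathbb{F}_q[T]$, and let $A_+$ be the set of monic polynomials in $A$. Let $e_C(z)$ be the Carlitz exponential function, $\tilde{\pi}\in\mathbb{C}_\infty$ a fundamental period of $e_C$, $\Gamma_m$ the Carlitz factorials and $BC_m$ the Bernoulli-Carlitz numbers. If $\alpha$ and $\beta$ are elements in $\mathbb{C}_\infty$ such that $\alpha\beta=\tilde{\pi}^2$ and if $j$ is a positive integer, then $$\alpha^{-\left(\frac{q-1}{2}\right)(j-1)-(q-2)}\sum_{a\in A_+}\frac{a^{-(q-1)j-(q-2)}}{e_C(\alpha a)}+\beta^{-\left(\frac{q-1}{2}\right)(j-1)-(q-2)}\sum_{a\in A_+}\frac{a^{-(q-1)j-(q-2)}}{e_C(\beta a)}$$ $$=\sum_{k=0}^{j+1}\frac{BC_{(q-1)k}}{\Gamma_{(q-1)k}}\,\frac{BC_{(q-1)(j-k+1)}}{\Gamma_{(q-1)(j-k+1)}}\,\alpha^{\left(\frac{q-1}{2}\right)k}\,\beta^{\left(\frac{q-1}{2}\right)(j-k+1)}.$$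
   Context: Let $q$ be a power of an odd prime $p$, $\mathbb{F}_q$ the field with $q$ elements, $A=\mathbb{F}_q[T]$, $K=\mathbb{F}_q(T)$, $K_\infty=\mathbb{F}_q((1/T))$ the completion of $K$ at the infinite place $(1/T)$, and $\mathbb{C}_\infty$ the completion of an algebraic closure of $K_\infty$. $A_+$ denotes the set of monic polynomials in $A$. For $i\ge 1$ put $[i]=T^{q^i}-T$ and $D_i=[i]\,[i-1]^{q}\cdots[1]^{q^{i-1}}$, and put $D_0=1$. The Carlitz exponential is the entire $\mathbb{F}_q$-linear function on $\mathbb{C}_\infty$ given by $$e_C(z)=\sum_{i=0}^{\infty}\frac{z^{q^i}}{D_i}.$$ The element $\tilde{\pi}\in\mathbb{C}_\infty$ is a fundamental period of $e_C$, the analogue of the classical $2\pi i$; one has the infinite product expansion $e_C(z)=z\prod_{0\ne\lambda\in\tilde{\pi}A}(1-z/\lambda)$. For a nonnegative integer $m$ with $q$-ary expansion $m=\sum_{i=0}^{w}c_iq^i$ ($0\le c_i<q$), the Carlitz factorial is $\Gamma_m=\prod_{i=0}^{w}D_i^{c_i}$. The Bernoulli-Carlitz numbers $BC_m\in K$ ($m=0,1,2,\ldots$) are defined by the generating function $$\frac{z}{e_C(z)}=\sum_{m=0}^{\infty}\frac{BC_m}{\Gamma_m}z^m,$$ with the understanding that $BC_0=\Gamma_0=1$.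
   Formalization: The identity is stated when no e_C(αa), e_C(βa) with a monic vanishes and both series converge; this is proved if α/π̃ is not in K_∞. Without it the left side can be undefined, e.g. α=β=π̃, where e_C(π̃a)=0. *)

theory Defs
  imports "HOL-Analysis.Analysis" "HOL-Algebra.Algebraic_Closure_Type"
begin

text \<open>
  The finite field with q elements is a type \<^typ>\<open>'k\<close> of sort field and finite, q being
  \<^term>\<open>CARD('k)\<close>. Then A is \<^typ>\<open>'k poly\<close>, K is \<^typ>\<open>'k poly fract\<close>, and the completion of K at
  the infinite place is \<^typ>\<open>'k fls\<close>, whose formal variable \<^term>\<open>fls_X\<close> stands for 1/T.
\<close>

subsection \<open>The embeddings of A and K into the completion at infinity\<close>

definition A_to_Kinf :: "'k::{field,finite} poly \<Rightarrow> 'k fls" where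
  "A_to_Kinf a = poly (map_poly fls_const a) fls_X_inv"

lemma A_to_Kinf_0 [simp]: "A_to_Kinf 0 = 0"
  by (simp add: A_to_Kinf_def)

lemma A_to_Kinf_pCons: "A_to_Kinf (pCons c a) = fls_const c + fls_X_inv * A_to_Kinf a"
  by (simp add: A_to_Kinf_def map_poly_pCons)

lemma A_to_Kinf_1 [simp]: "A_to_Kinf 1 = 1"
  by (simp add: one_pCons A_to_Kinf_pCons)

lemma A_to_Kinf_add: "A_to_Kinf (a + b) = A_to_Kinf a + A_to_Kinf b"
  by (induction a b rule: poly_induct2)
     (simp_all add: A_to_Kinf_pCons algebra_simps flip: fls_plus_const)

lemma A_to_Kinf_smult: "A_to_Kinf (Polynomial.smult c a) = fls_const c * A_to_Kinf a"
  by (induction a) (simp_all add: A_to_Kinf_pCons algebra_simps flip: fls_const_mult_const)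

lemma A_to_Kinf_mult: "A_to_Kinf (a * b) = A_to_Kinf a * A_to_Kinf b"
  by (induction a)
     (simp_all add: A_to_Kinf_pCons A_to_Kinf_add A_to_Kinf_smult algebra_simps)

lemma A_to_Kinf_nth: "fls_nth (A_to_Kinf a) n = (if n \<le> 0 then poly.coeff a (nat (- n)) else 0)"
proof (induction a arbitrary: n)
  case (pCons c a)
  show ?case
  proof (cases "n < 0")
    case True
    hence "nat (- n) = Suc (nat (- (n + 1)))"
      by simp
    with True show ?thesis
      by (simp add: A_to_Kinf_pCons pCons.IH fls_X_inv_times_conv_shift)
  qed (auto simp: A_to_Kinf_pCons pCons.IH fls_X_inv_times_conv_shift)
qed simp

lemma A_to_Kinf_eq_0_iff [simp]: "A_to_Kinf a = 0 \<longleftrightarrow> a = 0"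
proof
  assume "A_to_Kinf a = 0"
  hence "poly.coeff a n = 0" for n
    using A_to_Kinf_nth[of a "- int n"] by simp
  thus "a = 0"
    by (simp add: poly_eq_iff)
qed simp

definition K_to_Kinf :: "'k::{field,finite} poly fract \<Rightarrow> 'k fls" where
  "K_to_Kinf x = (THE y. \<exists>a b. b \<noteq> 0 \<and> x = Fract a b \<and> y = A_to_Kinf a / A_to_Kinf b)"

lemma K_to_Kinf_Fract:
  assumes "b \<noteq> 0"
  shows "K_to_Kinf (Fract a b) = A_to_Kinf a / A_to_Kinf b"
  unfolding K_to_Kinf_def
proof (rule the_equality)
  fix y
  assume "\<exists>a' b'. b' \<noteq> 0 \<and> Fract a b = Fract a' b' \<and> y = A_to_Kinf a' / A_to_Kinf b'"
  then obtain a' b' where b': "b' \<noteq> 0" and eq: "Fract a b = Fract a' b'"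
    and y: "y = A_to_Kinf a' / A_to_Kinf b'"
    by (elim exE conjE)
  from eq assms b' have "a * b' = a' * b"
    by (simp add: eq_fract)
  hence "A_to_Kinf a * A_to_Kinf b' = A_to_Kinf a' * A_to_Kinf b"
    by (simp flip: A_to_Kinf_mult)
  thus "y = A_to_Kinf a / A_to_Kinf b"
    using assms b' by (simp add: y frac_eq_eq)
qed (rule exI [of _ a], rule exI [of _ b], simp add: assms)

subsection \<open>The completion of the algebraic closure\<close>

definition abs_Kinf :: "'k::{field,finite} fls \<Rightarrow> real" where
  "abs_Kinf f = (if f = 0 then 0 else real CARD('k) powi (- fls_subdegree f))"

text \<open>
  The type \<^typ>\<open>'c\<close>, with the embedding \<open>\<iota>\<close>, is a completion of the algebraic closure of
  \<^typ>\<open>'k fls\<close>: a field, complete for an absolute value extending the one at infinity, in which the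
  algebraic closure is dense. The absolute value is \<^term>\<open>\<lambda>x. dist x 0\<close>, and completeness is
  supplied by the class \<^class>\<open>complete_space\<close>.
\<close>

locale C_infinity =
  fixes \<iota> :: "'k::{field,finite} fls alg_closure \<Rightarrow> 'c::{field,complete_space}"
  assumes embed_one: "\<iota> 1 = 1"
    and embed_add: "\<And>x y. \<iota> (x + y) = \<iota> x + \<iota> y"
    and embed_mult: "\<And>x y. \<iota> (x * y) = \<iota> x * \<iota> y"
    and dist_eq: "\<And>u v :: 'c. dist u v = dist (u - v) 0"
    and abs_mult: "\<And>u v :: 'c. dist (u * v) 0 = dist u 0 * dist v 0"
    and abs_add_le_max: "\<And>u v :: 'c. dist (u + v) 0 \<le> max (dist u 0) (dist v 0)"
    and abs_embed: "\<And>f. dist (\<iota> (to_ac f)) 0 = abs_Kinf f"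
    and dense_range: "closure (range \<iota>) = UNIV"

definition Kinf_embed :: "('k::{field,finite} fls alg_closure \<Rightarrow> 'c) \<Rightarrow> 'k fls \<Rightarrow> 'c" where
  "Kinf_embed \<iota> f = \<iota> (to_ac f)"

definition A_embed :: "('k::{field,finite} fls alg_closure \<Rightarrow> 'c) \<Rightarrow> 'k poly \<Rightarrow> 'c" where
  "A_embed \<iota> a = Kinf_embed \<iota> (A_to_Kinf a)"

definition K_embed :: "('k::{field,finite} fls alg_closure \<Rightarrow> 'c) \<Rightarrow> 'k poly fract \<Rightarrow> 'c" where
  "K_embed \<iota> x = Kinf_embed \<iota> (K_to_Kinf x)"

definition A_plus :: "'k::{field,finite} poly set" where
  "A_plus = {a. Polynomial.lead_coeff a = 1}"

subsection \<open>The Carlitz exponential and its fundamental periods\<close>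

definition carlitz_bracket :: "nat \<Rightarrow> 'k::{field,finite} poly" where
  "carlitz_bracket i = Polynomial.monom 1 (CARD('k) ^ i) - Polynomial.monom 1 1"

definition carlitz_D :: "nat \<Rightarrow> 'k::{field,finite} poly" where
  "carlitz_D i = (\<Prod>k=1..i. carlitz_bracket k ^ (CARD('k) ^ (i - k)))"

definition carlitz_exp ::
  "('k::{field,finite} fls alg_closure \<Rightarrow> 'c::{field,complete_space}) \<Rightarrow> 'c \<Rightarrow> 'c" where
  "carlitz_exp \<iota> z = (\<Sum>i. z ^ (CARD('k) ^ i) / A_embed \<iota> (carlitz_D i))"

definition fundamental_period ::
  "('k::{field,finite} fls alg_closure \<Rightarrow> 'c::{field,complete_space}) \<Rightarrow> 'c \<Rightarrow> bool" where
  "fundamental_period \<iota> \<omega> \<longleftrightarrow>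
     {\<mu>. \<forall>z. carlitz_exp \<iota> (z + \<mu>) = carlitz_exp \<iota> z} = range (\<lambda>a. \<omega> * A_embed \<iota> a)"

subsection \<open>Carlitz factorials and Bernoulli-Carlitz numbers\<close>

text \<open>
  The i-th q-ary digit of m is \<open>m div q ^ i mod q\<close>; it vanishes for \<open>i > m\<close>, so the product
  may run up to m.
\<close>

definition carlitz_factorial :: "nat \<Rightarrow> 'k::{field,finite} poly" where
  "carlitz_factorial m = (\<Prod>i\<le>m. carlitz_D i ^ (m div CARD('k) ^ i mod CARD('k)))"

text \<open>The Carlitz exponential as a formal power series over K.\<close>

definition carlitz_exp_fps :: "'k::{field,finite} poly fract fps" where
  "carlitz_exp_fps = Abs_fps (\<lambda>n. \<Sum>i | CARD('k) ^ i = n. 1 / to_fract (carlitz_D i))"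

definition bernoulli_carlitz :: "nat \<Rightarrow> 'k::{field,finite} poly fract" where
  "bernoulli_carlitz m =
     to_fract (carlitz_factorial m) * fps_nth (fps_X / carlitz_exp_fps) m"

subsection \<open>The series over monic polynomials\<close>

text \<open>
  Division by zero and divergent sums both yield zero in HOL, so that it has to be stated
  explicitly that the terms are defined and that the series converges. For the non-archimedean
  absolute value, unconditional summability amounts to the terms tending to zero.
\<close>

definition carlitz_series_converges ::
  "('k::{field,finite} fls alg_closure \<Rightarrow> 'c::{field,complete_space}) \<Rightarrow> nat \<Rightarrow> 'c \<Rightarrow> bool" where
  "carlitz_series_converges \<iota> j \<alpha> \<longleftrightarrow>
     (\<forall>a\<in>A_plus. carlitz_exp \<iota> (\<alpha> * A_embed \<iota> a) \<noteq> 0) \<and>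
     (\<lambda>a. A_embed \<iota> a powi (- (int CARD('k) - 1) * int j - (int CARD('k) - 2))
           / carlitz_exp \<iota> (\<alpha> * A_embed \<iota> a)) summable_on A_plus"

end

theory Submission
  imports Defs
begin

text \<open>
  Let \<open>s = q - 1\<close> and let \<open>\<omega>\<close> be the period. The identity \<open>e(T z) = T e(z) + e(z)\<^sup>q\<close> and the partial
  fraction decomposition of \<open>1 / (x\<^sup>q + T x)\<close> give
  \<open>1 / e(z) = T\<^sup>-\<^sup>1 \<Sum>\<^sub>c 1 / e((z - c \<omega>) / T)\<close> with \<open>c\<close> in the finite field. Iterating this and using that
  \<open>e\<close> is close to the identity on the ball of radius \<open>\<bar>\<omega>\<bar>\<close> yields \<open>1 / e(z) = \<Sum>\<^sub>b 1 / (z - \<omega> b)\<close>;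
  grouping the terms by the units of the finite field,
  \<open>1 - z / e(z)\<close> is the sum of \<open>z\<^sup>s / (z\<^sup>s - (\<omega> b)\<^sup>s)\<close> over the monic \<open>b\<close>. Expanding at the origin, the
  numbers \<open>BC\<^sub>m / \<Gamma>\<^sub>m\<close> are \<open>\<zeta>(m) / \<omega>\<^sup>m\<close> for positive multiples \<open>m\<close> of \<open>s\<close>.
  Inserting the partial fractions into the two series of the theorem gives two double sums over pairs of
  monic polynomials; after exchanging the summation variables in the second one, their terms add up to
  \<open>(p\<^sup>1\<^sup>-\<^sup>J - r\<^sup>1\<^sup>-\<^sup>J) / (p - r)\<close> with \<open>J = j + 1\<close>, where \<open>p\<close> depends only on \<open>a\<close> and \<open>r\<close> only on \<open>b\<close>. This is a
  finite sum of products, whose sums over \<open>(a, b)\<close> are products of zeta values.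
\<close>

section \<open>Summation over ultrametric fields\<close>

text \<open>The oddness of q enters through s = 2 h: since \<alpha> \<beta> = \<omega>^2, one has
  \<omega>^s = \<alpha>^h \<beta>^h, so a factor \<alpha>^h cancels from the term of the first
  double sum and \<beta>^h from that of the second. This leaves p = \<alpha>^h a^s and r = \<beta>^h
  b^s in both. The boundary terms k = 0 and k = j + 1 are the two zeta values that remain because 1
  - z / e(z) is summed and not z / e(z). The iterated identity for 1 / e(z) is exact for every
  degree bound, and replacing e by the identity map costs the same small error in all its summands;
  by the ultrametric inequality this error does not accumulate. The ball where e preserves absolute
  values is found from \<bar>\<omega>\<bar>^s = q^q, whose upper bound rests on a nonzero zero of e
  obtained by contraction. The obstacle is the exchange of summations: the denominators \<alpha> a -
  \<omega> b need not stay away from zero, so summability over pairs has to be derived from the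
  assumed convergence of the single series.\<close>

text \<open>
  The class of \<^typ>\<open>'c\<close> does not relate the metric to the field operations, so that the library lemmas
  on limits and infinite sums in topological groups are not applicable.
\<close>

locale ultrametric_field =
  fixes nrm :: "'c::{field,complete_space} \<Rightarrow> real"
  assumes dist_nrm: "dist u v = nrm (u - v)"
    and nrm_mult: "nrm (u * v) = nrm u * nrm v"
    and nrm_add_le_max: "nrm (u + v) \<le> max (nrm u) (nrm v)"
begin

lemma nrm_nonneg [simp]: "0 \<le> nrm x"
  using dist_nrm[of x 0] by (metis diff_zero zero_le_dist)

lemma nrm_eq_0_iff [simp]: "nrm x = 0 \<longleftrightarrow> x = 0"
  using dist_nrm[of x 0] by (metis diff_zero dist_eq_0_iff)

lemma nrm_pos_iff [simp]: "0 < nrm x \<longleftrightarrow> x \<noteq> 0"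
  using nrm_nonneg[of x] nrm_eq_0_iff[of x] by linarith

lemma nrm_0 [simp]: "nrm 0 = 0"
  by (simp only: nrm_eq_0_iff)

lemma nrm_1 [simp]: "nrm 1 = 1"
  using nrm_mult[of 1 1] nrm_pos_iff[of 1] by simp

lemma nrm_minus [simp]: "nrm (- x) = nrm x"
proof -
  have "nrm (- 1) * nrm (- 1) = 1"
    using nrm_mult[of "- 1" "- 1"] by simp
  then have "nrm (- 1) = 1"
    using nrm_nonneg[of "- 1"] by (metis abs_of_nonneg abs_mult_self_eq real_sqrt_abs2 real_sqrt_one)
  then show ?thesis
    using nrm_mult[of "- 1" x] by simp
qed

lemma nrm_minus_commute: "nrm (x - y) = nrm (y - x)"
  by (metis minus_diff_eq nrm_minus)

lemma nrm_power: "nrm (x ^ n) = nrm x ^ n"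
  by (induction n) (simp_all add: nrm_mult)

lemma nrm_inverse: "nrm (inverse x) = inverse (nrm x)"
proof (cases "x = 0")
  case False
  then have "nrm x * nrm (inverse x) = 1"
    using nrm_mult[of x "inverse x"] by simp
  then show ?thesis
    by (metis inverse_unique)
qed simp

lemma nrm_divide: "nrm (x / y) = nrm x / nrm y"
  by (simp add: divide_inverse nrm_mult nrm_inverse)

lemma nrm_diff_le_max: "nrm (x - y) \<le> max (nrm x) (nrm y)"
  using nrm_add_le_max[of x "- y"] by simp

lemma nrm_diff_le: "nrm x \<le> M \<Longrightarrow> nrm y \<le> M \<Longrightarrow> nrm (x - y) \<le> M"
  using nrm_diff_le_max[of x y] by simp

lemma nrm_add_le: "nrm x \<le> M \<Longrightarrow> nrm y \<le> M \<Longrightarrow> nrm (x + y) \<le> M"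
  using nrm_add_le_max[of x y] by simp

text \<open>Isosceles principle: x = (x + y) - y, and in the resulting bound for
  \<open>nrm x\<close> the maximum cannot be \<open>nrm y\<close>.\<close>

lemma nrm_add_eq: "nrm y < nrm x \<Longrightarrow> nrm (x + y) = nrm x"
  using nrm_add_le_max[of x y] nrm_diff_le_max[of "x + y" y] by (simp add: max_def split: if_splits)

lemma nrm_diff_eq: "nrm y < nrm x \<Longrightarrow> nrm (x - y) = nrm x"
  using nrm_add_eq[of "- y" x] by simp

lemma nrm_sum_le: "0 \<le> M \<Longrightarrow> (\<And>a. a \<in> A \<Longrightarrow> nrm (f a) \<le> M) \<Longrightarrow> nrm (sum f A) \<le> M"
proof (induction A rule: infinite_finite_induct)
  case (insert a A)
  then show ?case
    using nrm_add_le_max[of "f a" "sum f A"] by force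
qed auto

lemma tendsto_nrm_iff: "(f \<longlongrightarrow> l) F \<longleftrightarrow> ((\<lambda>x. nrm (f x - l)) \<longlongrightarrow> 0) F"
  by (simp add: tendsto_dist_iff[of f] dist_nrm)

lemma nrm_limit_le:
  assumes "f \<longlonglongrightarrow> l" "\<And>n. nrm (f n) \<le> M"
  shows "nrm l \<le> M"
proof (rule field_le_epsilon)
  fix e :: real assume "e > 0"
  with assms(1) obtain n where "nrm (f n - l) < e"
    unfolding lim_sequentially dist_nrm by blast
  then show "nrm l \<le> M + e"
    using nrm_diff_le_max[of "f n" "f n - l"] assms(2)[of n] \<open>e > 0\<close>
      order_trans[OF nrm_nonneg assms(2)[of n]]
    by (simp add: max_def split: if_splits)
qed

text \<open>Convergence to zero along the cofinite filter on \<open>A\<close>. In a complete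
  ultrametric field this is equivalent to unconditional summability; \<open>has_sum_null_on\<close>
  and \<open>null_on_summable\<close> are the two directions.\<close>

definition null_on :: "('i \<Rightarrow> 'c) \<Rightarrow> 'i set \<Rightarrow> bool" where
  "null_on f A \<longleftrightarrow> (\<forall>e>0. finite {a\<in>A. e \<le> nrm (f a)})"

lemma null_onD: "null_on f A \<Longrightarrow> e > 0 \<Longrightarrow> finite {a\<in>A. e \<le> nrm (f a)}"
  by (simp add: null_on_def)

lemma null_on_mono:
  assumes "null_on f A" "\<And>a. a \<in> A \<Longrightarrow> nrm (g a) \<le> M * nrm (f a)"
  shows "null_on g A"
  unfolding null_on_def
proof (intro allI impI)
  fix e :: real assume e: "e > 0"
  define N where "N = max M 1"
  have "nrm (g a) \<le> N * nrm (f a)" if "a \<in> A" for a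
    using assms(2)[OF that] mult_right_mono[of M N "nrm (f a)"] by (simp add: N_def)
  then have "{a\<in>A. e \<le> nrm (g a)} \<subseteq> {a\<in>A. e / N \<le> nrm (f a)}"
    by (fastforce simp: N_def pos_divide_le_eq mult.commute)
  moreover have "e / N > 0"
    using e by (simp add: N_def)
  ultimately show "finite {a\<in>A. e \<le> nrm (g a)}"
    using null_onD[OF assms(1)] finite_subset by blast
qed

lemma null_on_bounded:
  assumes "null_on f A"
  obtains M where "M > 0" "\<And>a. a \<in> A \<Longrightarrow> nrm (f a) \<le> M"
proof
  define B where "B = {a\<in>A. 1 \<le> nrm (f a)}"
  have B: "finite B"
    using null_onD[OF assms, of 1] by (simp add: B_def)
  show "0 < Max (insert 1 ((\<lambda>a. nrm (f a)) ` B))"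
    using B by (simp add: Max_gr_iff)
  fix a assume "a \<in> A"
  show "nrm (f a) \<le> Max (insert 1 ((\<lambda>a. nrm (f a)) ` B))"
  proof (cases "a \<in> B")
    case False
    then have "nrm (f a) \<le> 1" using \<open>a \<in> A\<close> by (simp add: B_def)
    then show ?thesis
      using B by (simp add: Max_ge_iff)
  qed (use B in \<open>auto intro!: Max_ge\<close>)
qed

text \<open>Both factors are bounded, so a product of norm at least \<open>e\<close> forces each
  factor above a fixed positive bound, which leaves finitely many choices for each.\<close>

lemma null_on_product:
  assumes "null_on f A" "null_on g B"
  shows "null_on (\<lambda>(a, b). f a * g b) (A \<times> B)"
  unfolding null_on_def
proof (intro allI impI)
  fix e :: real assume e: "e > 0"
  obtain M where M: "M > 0" "\<And>a. a \<in> A \<Longrightarrow> nrm (f a) \<le> M"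
    using null_on_bounded[OF assms(1)] by metis
  obtain N where N: "N > 0" "\<And>b. b \<in> B \<Longrightarrow> nrm (g b) \<le> N"
    using null_on_bounded[OF assms(2)] by metis
  have "e / N \<le> nrm (f a) \<and> e / M \<le> nrm (g b)"
    if "a \<in> A" "b \<in> B" "e \<le> nrm (f a * g b)" for a b
  proof -
    have "nrm (f a) * nrm (g b) \<le> nrm (f a) * N" "nrm (f a) * nrm (g b) \<le> M * nrm (g b)"
      using M(2)[OF that(1)] N(2)[OF that(2)] by (auto intro: mult_left_mono mult_right_mono)
    with that(3) M(1) N(1) show ?thesis
      by (auto simp: nrm_mult field_simps)
  qed
  then have "{p \<in> A \<times> B. e \<le> nrm (case p of (a, b) \<Rightarrow> f a * g b)}
      \<subseteq> {a\<in>A. e / N \<le> nrm (f a)} \<times> {b\<in>B. e / M \<le> nrm (g b)}"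
    by auto
  then show "finite {p \<in> A \<times> B. e \<le> nrm (case p of (a, b) \<Rightarrow> f a * g b)}"
    by (rule finite_subset) (use assms e M(1) N(1) in \<open>simp add: null_onD\<close>)
qed

section \<open>Unordered sums and their exchange\<close>

lemma has_sum_nrm_iff:
  "(f has_sum S) A \<longleftrightarrow>
    (\<forall>e>0. \<exists>U. finite U \<and> U \<subseteq> A \<and> (\<forall>Y. finite Y \<and> U \<subseteq> Y \<and> Y \<subseteq> A \<longrightarrow> nrm (sum f Y - S) < e))"
  by (simp add: has_sum_def tendsto_iff eventually_finite_subsets_at_top dist_nrm)

lemma has_sum_null_on:
  assumes "(f has_sum S) A"
  shows "null_on f A"
  unfolding null_on_def
proof (intro allI impI)
  fix e :: real assume "e > 0"
  then obtain U where U: "finite U" "U \<subseteq> A"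
    "\<And>Y. finite Y \<Longrightarrow> U \<subseteq> Y \<Longrightarrow> Y \<subseteq> A \<Longrightarrow> nrm (sum f Y - S) < e"
    using assms unfolding has_sum_nrm_iff by meson
  have "nrm (f a) < e" if "a \<in> A - U" for a
  proof -
    have "nrm (sum f (insert a U) - S) < e" "nrm (sum f U - S) < e"
      using U(1,2) that by (auto intro!: U(3) simp del: sum.insert)
    moreover have "f a = (sum f (insert a U) - S) - (sum f U - S)"
      using U that by simp
    ultimately show ?thesis
      by (metis le_less_trans max_less_iff_conj nrm_diff_le_max)
  qed
  then have "{a\<in>A. e \<le> nrm (f a)} \<subseteq> U"
    by fastforce
  then show "finite {a\<in>A. e \<le> nrm (f a)}"
    using U(1) finite_subset by blast
qed

text \<open>A finite set \<open>U\<close> whose supersets approximate \<open>S\<close> may be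
  enlarged by \<open>F\<close>; removing the surplus terms again costs no more than the largest of
  them. Truncation errors are thus controlled by single omitted terms.\<close>

lemma has_sum_approx:
  assumes S: "(f has_sum S) A"
    and F: "finite F" "F \<subseteq> A" "\<And>a. a \<in> A - F \<Longrightarrow> nrm (f a) \<le> e"
    and e: "e > 0"
  shows "nrm (sum f F - S) \<le> e"
proof -
  obtain U where U: "finite U" "U \<subseteq> A"
    "\<And>Y. finite Y \<Longrightarrow> U \<subseteq> Y \<Longrightarrow> Y \<subseteq> A \<Longrightarrow> nrm (sum f Y - S) < e"
    using S e unfolding has_sum_nrm_iff by meson
  let ?G = "U \<union> F"
  have "nrm (sum f ?G - S) \<le> e"
    using U(1,2) F(1,2) U(3)[of ?G] by simp
  moreover have "nrm (sum f (?G - F)) \<le> e"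
    using U(2) F(3) e by (intro nrm_sum_le) auto
  moreover have "sum f F - S = (sum f ?G - S) - sum f (?G - F)"
    using U(1) F(1) by (simp add: sum_diff)
  ultimately show ?thesis
    by (simp only: nrm_diff_le)
qed

text \<open>The partial sums over the terms of norm at least 1 / (n + 1) form a Cauchy sequence,
  because a finite sum of omitted terms is no larger than its largest term.\<close>

lemma null_on_summable:
  assumes "null_on f A"
  shows "f summable_on A"
proof -
  define F where "F n = {a\<in>A. 1 / real (Suc n) \<le> nrm (f a)}" for n
  have fin: "finite (F n)" for n
    unfolding F_def by (rule null_onD[OF assms]) simp
  have mono: "F m \<subseteq> F n" if "m \<le> n" for m n
  proof -
    have "1 / real (Suc n) \<le> 1 / real (Suc m)"
      using that by (simp add: field_simps)
    then show ?thesis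
      by (fastforce simp: F_def)
  qed
  have near: "nrm (sum f Y - sum f (F n)) \<le> 1 / real (Suc n)"
    if "finite Y" "F n \<subseteq> Y" "Y \<subseteq> A" for Y n
  proof -
    have "nrm (sum f (Y - F n)) \<le> 1 / real (Suc n)"
      using that(3) by (intro nrm_sum_le) (auto simp: F_def)
    then show ?thesis
      using that fin by (simp add: sum_diff)
  qed
  have FA: "F n \<subseteq> A" for n
    by (auto simp: F_def)
  have small: "\<exists>n. 1 / real (Suc n) < e" if "e > 0" for e :: real
    using that nat_approx_posE by blast
  have "Cauchy (\<lambda>n. sum f (F n))"
    unfolding Cauchy_altdef2
  proof (intro allI impI)
    fix e :: real assume "e > 0"
    then obtain N where "1 / real (Suc N) < e"
      using small by blast
    then show "\<exists>N. \<forall>n\<ge>N. dist (sum f (F n)) (sum f (F N)) < e"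
      using near[OF fin mono FA] unfolding dist_nrm by (meson le_less_trans)
  qed
  then obtain S where S: "(\<lambda>n. sum f (F n)) \<longlonglongrightarrow> S"
    using Cauchy_convergent_iff convergent_def by blast
  have "(f has_sum S) A"
    unfolding has_sum_nrm_iff
  proof (intro allI impI)
    fix e :: real assume e: "e > 0"
    obtain m where m: "\<And>n. n \<ge> m \<Longrightarrow> nrm (sum f (F n) - S) < e"
      using S e unfolding lim_sequentially dist_nrm by blast
    obtain k where k: "1 / real (Suc k) < e"
      using small e by blast
    define n where "n = max m k"
    have n: "1 / real (Suc n) < e"
      using k by (rule le_less_trans[rotated]) (simp add: n_def field_simps)
    have "nrm (sum f Y - S) < e" if "finite Y" "F n \<subseteq> Y" "Y \<subseteq> A" for Y
    proof -
      have "nrm ((sum f Y - sum f (F n)) + (sum f (F n) - S))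
          \<le> max (nrm (sum f Y - sum f (F n))) (nrm (sum f (F n) - S))"
        by (rule nrm_add_le_max)
      also have "\<dots> < e"
        using near[OF that] m[of n] n by (simp add: n_def)
      finally show ?thesis
        by simp
    qed
    then show "\<exists>U. finite U \<and> U \<subseteq> A \<and>
        (\<forall>Y. finite Y \<and> U \<subseteq> Y \<and> Y \<subseteq> A \<longrightarrow> nrm (sum f Y - S) < e)"
      by (intro exI[of _ "F n"] conjI fin FA) simp
  qed
  then show ?thesis
    by (rule has_sum_imp_summable)
qed

lemma has_sum_null_onE:
  assumes "null_on f A"
  obtains S where "(f has_sum S) A"
  using null_on_summable[OF assms] that by (auto simp: summable_on_def)

lemma has_sum_unique_nrm:
  fixes f :: "'i \<Rightarrow> 'c"
  shows "(f has_sum x) A \<Longrightarrow> (f has_sum y) A \<Longrightarrow> x = y"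
  using infsumI by blast

lemma has_sum_add_nrm:
  fixes f g :: "'i \<Rightarrow> 'c"
  assumes "(f has_sum x) A" "(g has_sum y) A"
  shows "((\<lambda>a. f a + g a) has_sum (x + y)) A"
  unfolding has_sum_nrm_iff
proof (intro allI impI)
  fix e :: real assume e: "e > 0"
  obtain U where U: "finite U" "U \<subseteq> A"
    "\<And>Y. finite Y \<Longrightarrow> U \<subseteq> Y \<Longrightarrow> Y \<subseteq> A \<Longrightarrow> nrm (sum f Y - x) < e"
    using assms(1) e unfolding has_sum_nrm_iff by meson
  obtain Z where Z: "finite Z" "Z \<subseteq> A"
    "\<And>Y. finite Y \<Longrightarrow> Z \<subseteq> Y \<Longrightarrow> Y \<subseteq> A \<Longrightarrow> nrm (sum g Y - y) < e"
    using assms(2) e unfolding has_sum_nrm_iff by meson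
  have "nrm ((\<Sum>a\<in>Y. f a + g a) - (x + y)) < e" if "finite Y" "U \<union> Z \<subseteq> Y" "Y \<subseteq> A" for Y
  proof -
    have "nrm ((sum f Y - x) + (sum g Y - y)) \<le> max (nrm (sum f Y - x)) (nrm (sum g Y - y))"
      by (rule nrm_add_le_max)
    also have "\<dots> < e"
      using U(3)[of Y] Z(3)[of Y] that by simp
    finally show ?thesis
      by (simp add: sum.distrib algebra_simps)
  qed
  then show "\<exists>U. finite U \<and> U \<subseteq> A \<and>
      (\<forall>Y. finite Y \<and> U \<subseteq> Y \<and> Y \<subseteq> A \<longrightarrow> nrm ((\<Sum>a\<in>Y. f a + g a) - (x + y)) < e)"
    using U(1,2) Z(1,2) by (intro exI[of _ "U \<union> Z"] conjI) auto
qed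

lemma has_sum_cmult_nrm:
  fixes f :: "'i \<Rightarrow> 'c"
  assumes "(f has_sum x) A"
  shows "((\<lambda>a. c * f a) has_sum (c * x)) A"
proof (cases "c = 0")
  case False
  show ?thesis
    unfolding has_sum_nrm_iff
  proof (intro allI impI)
    fix e :: real assume e: "e > 0"
    then have "e / nrm c > 0"
      using False by simp
    then obtain U where U: "finite U" "U \<subseteq> A"
      "\<And>Y. finite Y \<Longrightarrow> U \<subseteq> Y \<Longrightarrow> Y \<subseteq> A \<Longrightarrow> nrm (sum f Y - x) < e / nrm c"
      using assms unfolding has_sum_nrm_iff by meson
    have "nrm ((\<Sum>a\<in>Y. c * f a) - c * x) < e" if "finite Y" "U \<subseteq> Y" "Y \<subseteq> A" for Y
      using U(3)[OF that] False
      by (simp add: nrm_mult pos_less_divide_eq mult.commute flip: sum_distrib_left right_diff_distrib)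
    then show "\<exists>U. finite U \<and> U \<subseteq> A \<and>
        (\<forall>Y. finite Y \<and> U \<subseteq> Y \<and> Y \<subseteq> A \<longrightarrow> nrm ((\<Sum>a\<in>Y. c * f a) - c * x) < e)"
      using U(1,2) by (intro exI[of _ U] conjI) auto
  qed
qed (simp add: has_sum_nrm_iff; blast)

lemma has_sum_diff_nrm:
  fixes f g :: "'i \<Rightarrow> 'c"
  shows "(f has_sum x) A \<Longrightarrow> (g has_sum y) A \<Longrightarrow> ((\<lambda>a. f a - g a) has_sum (x - y)) A"
  using has_sum_add_nrm[OF _ has_sum_cmult_nrm[where f = g and c = "- 1"], where f = f] by simp

lemma has_sum_sum_nrm:
  fixes f :: "'j \<Rightarrow> 'i \<Rightarrow> 'c"
  assumes "finite I" "\<And>i. i \<in> I \<Longrightarrow> (f i has_sum x i) A"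
  shows "((\<lambda>a. \<Sum>i\<in>I. f i a) has_sum (\<Sum>i\<in>I. x i)) A"
  using assms
proof (induction I rule: finite_induct)
  case empty
  show ?case by (simp add: has_sum_nrm_iff; blast)
next
  case (insert i I)
  then show ?case by (simp add: has_sum_add_nrm)
qed

lemma has_sum_nrm_le:
  assumes "(f has_sum S) A" "\<And>a. a \<in> A \<Longrightarrow> nrm (f a) \<le> M" "0 \<le> M"
  shows "nrm S \<le> M"
proof (rule field_le_epsilon)
  fix e :: real assume "e > 0"
  then have "nrm (sum f {} - S) \<le> M + e"
    using assms by (intro has_sum_approx) (auto intro: order_trans[OF assms(2)])
  then show "nrm S \<le> M + e"
    by simp
qed

text \<open>Fubini for one order. The finite set \<open>Z\<close> of large terms lies in finitely
  many columns; cutting every row to these columns changes each row sum by at most e / 2, hence also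
  any finite sum of row sums.\<close>

lemma has_sum_rows:
  fixes f :: "'i \<times> 'j \<Rightarrow> 'c"
  assumes S: "(f has_sum S) (A \<times> B)"
    and g: "\<And>a. a \<in> A \<Longrightarrow> ((\<lambda>b. f (a, b)) has_sum g a) B"
  shows "(g has_sum S) A"
  unfolding has_sum_nrm_iff
proof (intro allI impI)
  fix e :: real assume e: "e > 0"
  define Z where "Z = {p\<in>A\<times>B. e / 2 \<le> nrm (f p)}"
  have Z: "finite Z"
    unfolding Z_def using null_onD[OF has_sum_null_on[OF S], of "e / 2"] e by simp
  let ?G = "snd ` Z"
  have "nrm (sum g Y - S) < e" if Y: "finite Y" "fst ` Z \<subseteq> Y" "Y \<subseteq> A" for Y
  proof -
    have "nrm ((\<Sum>b\<in>?G. f (a, b)) - g a) \<le> e / 2" if "a \<in> Y" for a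
    proof (rule has_sum_approx[OF g])
      show "nrm (f (a, b)) \<le> e / 2" if "b \<in> B - ?G" for b
        using that \<open>a \<in> Y\<close> Y(3) by (force simp: Z_def image_iff)
    qed (use that Y Z e in \<open>auto simp: Z_def\<close>)
    then have "nrm (\<Sum>a\<in>Y. (\<Sum>b\<in>?G. f (a, b)) - g a) \<le> e / 2"
      using e by (intro nrm_sum_le) auto
    moreover have "nrm (sum f (Y \<times> ?G) - S) \<le> e / 2"
    proof (rule has_sum_approx[OF S])
      show "nrm (f p) \<le> e / 2" if "p \<in> A \<times> B - Y \<times> ?G" for p
      proof -
        have "p \<notin> Z"
          using that Y(2) by (metis DiffE imageI mem_Times_iff subsetD)
        then show ?thesis
          using that by (auto simp: Z_def)
      qed
      show "Y \<times> ?G \<subseteq> A \<times> B"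
        using Y(3) by (auto simp: Z_def)
    qed (use Y(1) Z e in auto)
    moreover have "sum g Y - S = (sum f (Y \<times> ?G) - S) - (\<Sum>a\<in>Y. (\<Sum>b\<in>?G. f (a, b)) - g a)"
      by (simp add: sum.cartesian_product sum_subtractf)
    ultimately have "nrm (sum g Y - S) \<le> e / 2"
      by (simp only: nrm_diff_le)
    then show ?thesis
      using e by simp
  qed
  moreover have "fst ` Z \<subseteq> A"
    by (auto simp: Z_def)
  ultimately show "\<exists>U. finite U \<and> U \<subseteq> A \<and>
      (\<forall>Y. finite Y \<and> U \<subseteq> Y \<and> Y \<subseteq> A \<longrightarrow> nrm (sum g Y - S) < e)"
    using Z by (intro exI[of _ "fst ` Z"] conjI) auto
qed

lemma has_sum_product_nrm:
  fixes f :: "'i \<Rightarrow> 'c" and g :: "'j \<Rightarrow> 'c"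
  assumes "(f has_sum x) A" "(g has_sum y) B"
  shows "((\<lambda>(a, b). f a * g b) has_sum (x * y)) (A \<times> B)"
proof -
  obtain S where S: "((\<lambda>(a, b). f a * g b) has_sum S) (A \<times> B)"
    using has_sum_null_onE[OF null_on_product[OF has_sum_null_on has_sum_null_on]] assms by metis
  have "((\<lambda>a. f a * y) has_sum S) A"
    by (rule has_sum_rows[OF S]) (simp add: has_sum_cmult_nrm assms(2))
  moreover have "((\<lambda>a. f a * y) has_sum (x * y)) A"
    using has_sum_cmult_nrm[OF assms(1), of y] by (simp only: mult.commute)
  ultimately have "S = x * y"
    by (rule has_sum_unique_nrm)
  with S show ?thesis
    by simp
qed

lemma has_sum_exhaust_limit:
  fixes f :: "'i \<Rightarrow> 'c"
  assumes S: "(f has_sum S) A"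
    and F: "\<And>n. finite (F n)" "\<And>n. F n \<subseteq> A" "mono F" "A \<subseteq> (\<Union>n. F n)"
  shows "(\<lambda>n. sum f (F n)) \<longlonglongrightarrow> S"
  unfolding lim_sequentially dist_nrm
proof (intro allI impI)
  fix e :: real assume "e > 0"
  then obtain U where U: "finite U" "U \<subseteq> A"
    "\<And>Y. finite Y \<Longrightarrow> U \<subseteq> Y \<Longrightarrow> Y \<subseteq> A \<Longrightarrow> nrm (sum f Y - S) < e"
    using S unfolding has_sum_nrm_iff by meson
  obtain k where k: "\<And>x. x \<in> U \<Longrightarrow> x \<in> F (k x)"
    using U(2) F(4) by (metis UN_E subset_iff)
  have "U \<subseteq> F n" if "n \<ge> Max (insert 0 (k ` U))" for n
  proof
    fix x assume x: "x \<in> U"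
    then have "k x \<le> n"
      using that U(1) by simp
    then show "x \<in> F n"
      using k[OF x] monoD[OF F(3)] by blast
  qed
  then show "\<exists>N. \<forall>n\<ge>N. nrm (sum f (F n) - S) < e"
    using U(3) F(1,2) by (intro exI[of _ "Max (insert 0 (k ` U))"] allI impI) auto
qed

lemma has_sum_sums_nrm:
  fixes f :: "nat \<Rightarrow> 'c"
  shows "(f has_sum S) UNIV \<Longrightarrow> f sums S"
  unfolding sums_def
  by (rule has_sum_exhaust_limit) (auto simp: mono_def)

subsection \<open>Asymptotic expansions at the origin\<close>

text \<open>Asymptotic only: no convergence of \<open>F\<close> is asked, since products and
  uniqueness suffice to compare coefficients. The origin is excluded because the quotient
  \<open>z / e z\<close> to be expanded takes there the default value 0 instead of 1.\<close>

definition has_expansion :: "('c \<Rightarrow> 'c) \<Rightarrow> 'c fps \<Rightarrow> bool" where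
  "has_expansion h F \<longleftrightarrow> (\<forall>m. \<exists>C r. r > 0 \<and>
     (\<forall>z. z \<noteq> 0 \<and> nrm z < r \<longrightarrow> nrm (h z - (\<Sum>n<m. fps_nth F n * z ^ n)) \<le> C * nrm z ^ m))"

lemma has_expansionD:
  assumes "has_expansion h F"
  obtains C r where "C > 0" "r > 0" "r \<le> 1"
    "\<And>z. z \<noteq> 0 \<Longrightarrow> nrm z < r \<Longrightarrow> nrm (h z - (\<Sum>n<m. fps_nth F n * z ^ n)) \<le> C * nrm z ^ m"
proof -
  obtain C r where Cr: "r > 0"
    "\<And>z. z \<noteq> 0 \<Longrightarrow> nrm z < r \<Longrightarrow> nrm (h z - (\<Sum>n<m. fps_nth F n * z ^ n)) \<le> C * nrm z ^ m"
    using assms unfolding has_expansion_def by meson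
  show ?thesis
  proof (rule that[of "max C 1" "min r 1"])
    fix z assume "z \<noteq> 0" "nrm z < min r 1"
    then have "nrm (h z - (\<Sum>n<m. fps_nth F n * z ^ n)) \<le> C * nrm z ^ m"
      using Cr(2) by simp
    also have "\<dots> \<le> max C 1 * nrm z ^ m"
      by (intro mult_right_mono) auto
    finally show "nrm (h z - (\<Sum>n<m. fps_nth F n * z ^ n)) \<le> max C 1 * nrm z ^ m" .
  qed (use Cr(1) in auto)
qed

lemma has_expansion_bounded:
  assumes "has_expansion h F"
  obtains C r where "C > 0" "r > 0" "\<And>z. z \<noteq> 0 \<Longrightarrow> nrm z < r \<Longrightarrow> nrm (h z) \<le> C"
  using has_expansionD[OF assms, where m = 0] that by (simp; metis)

text \<open>For the truncations P, Q, R at order m,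
  \<open>h k - R = (h - P) k + P (k - Q) + (P Q - R)\<close>; the last bracket consists of the
  monomials with i, j < m and i + j \<ge> m.\<close>

lemma has_expansion_mult:
  assumes h: "has_expansion h F" and k: "has_expansion k G"
  shows "has_expansion (\<lambda>z. h z * k z) (F * G)"
  unfolding has_expansion_def
proof
  fix m
  let ?P = "\<lambda>z. \<Sum>n<m. fps_nth F n * z ^ n" and ?Q = "\<lambda>z. \<Sum>n<m. fps_nth G n * z ^ n"
    and ?R = "\<lambda>z. \<Sum>n<m. fps_nth (F * G) n * z ^ n"
  obtain C1 r1 where 1: "C1 > 0" "r1 > 0" "r1 \<le> 1"
    "\<And>z. z \<noteq> 0 \<Longrightarrow> nrm z < r1 \<Longrightarrow> nrm (h z - ?P z) \<le> C1 * nrm z ^ m"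
    by (rule has_expansionD[OF h, where m = m]) (rule that; assumption)
  obtain C2 r2 where 2: "C2 > 0" "r2 > 0" "r2 \<le> 1"
    "\<And>z. z \<noteq> 0 \<Longrightarrow> nrm z < r2 \<Longrightarrow> nrm (k z - ?Q z) \<le> C2 * nrm z ^ m"
    by (rule has_expansionD[OF k, where m = m]) (rule that; assumption)
  obtain C3 r3 where 3: "C3 > 0" "r3 > 0" "\<And>z. z \<noteq> 0 \<Longrightarrow> nrm z < r3 \<Longrightarrow> nrm (h z) \<le> C3"
    by (rule has_expansion_bounded[OF h]) (rule that; assumption)
  obtain C4 r4 where 4: "C4 > 0" "r4 > 0" "\<And>z. z \<noteq> 0 \<Longrightarrow> nrm z < r4 \<Longrightarrow> nrm (k z) \<le> C4"
    by (rule has_expansion_bounded[OF k]) (rule that; assumption)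
  define C5 where "C5 = Max (insert 1 ((\<lambda>(i, j). nrm (fps_nth F i * fps_nth G j)) ` ({..<m} \<times> {..<m})))"
  have C5: "C5 > 0" "\<And>i j. i < m \<Longrightarrow> j < m \<Longrightarrow> nrm (fps_nth F i * fps_nth G j) \<le> C5"
    unfolding C5_def by (subst Max_gr_iff) (auto intro!: Max_ge)
  define r where "r = min (min r1 r2) (min r3 r4)"
  \<comment> \<open>The three errors combine by maximum, not by sum. \<open>max C1 C3\<close> bounds
    the truncation P, because \<open>nrm z ^ m\<close> is at most 1.\<close>
  define C where "C = max (C1 * C4) (max (max C1 C3 * C2) C5)"
  have "nrm (h z * k z - ?R z) \<le> C * nrm z ^ m" if z: "z \<noteq> 0" "nrm z < r" for z
  proof -
    have zr: "nrm z < r1" "nrm z < r2" "nrm z < r3" "nrm z < r4"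
      using z(2) by (auto simp: r_def)
    have zm: "nrm z ^ m \<le> 1" and z1: "nrm z \<le> 1"
      using zr 1(3) by (auto simp: power_le_one)
    have "nrm (h z - ?P z) \<le> C1 * nrm z ^ m"
      by (rule 1(4)[OF z(1) zr(1)])
    also have "\<dots> \<le> max C1 C3"
      using mult_left_mono[OF zm, of C1] 1(1) by (simp add: le_max_iff_disj)
    finally have "nrm (h z - (h z - ?P z)) \<le> max C1 C3"
      by (rule nrm_diff_le[rotated]) (use 3(3)[OF z(1) zr(3)] in \<open>simp add: le_max_iff_disj\<close>)
    then have P: "nrm (?P z) \<le> max C1 C3"
      by (simp only: diff_diff_eq2 add_diff_cancel_left')
    have a: "nrm ((h z - ?P z) * k z) \<le> C1 * C4 * nrm z ^ m"
    proof -
      have "nrm (h z - ?P z) * nrm (k z) \<le> (C1 * nrm z ^ m) * C4"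
        by (rule mult_mono[OF 1(4)[OF z(1) zr(1)] 4(3)[OF z(1) zr(4)]]) (use 1(1) in auto)
      then show ?thesis by (simp only: nrm_mult mult_ac)
    qed
    have b: "nrm (?P z * (k z - ?Q z)) \<le> max C1 C3 * C2 * nrm z ^ m"
    proof -
      have "nrm (?P z) * nrm (k z - ?Q z) \<le> max C1 C3 * (C2 * nrm z ^ m)"
        by (rule mult_mono[OF P 2(4)[OF z(1) zr(2)]]) (use 1(1) in auto)
      then show ?thesis by (simp only: nrm_mult mult_ac)
    qed
    have c: "nrm (?P z * ?Q z - ?R z) \<le> C5 * nrm z ^ m"
    proof -
      let ?t = "\<lambda>(i, j). fps_nth F i * z ^ i * (fps_nth G j * z ^ j)"
      have sub: "{(i, j). i + j < m} \<subseteq> {..<m} \<times> {..<m}"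
        by auto
      have "?R z = (\<Sum>n<m. \<Sum>i\<le>n. fps_nth F i * z ^ i * (fps_nth G (n - i) * z ^ (n - i)))"
        by (intro sum.cong refl)
           (simp add: fps_mult_nth atLeast0AtMost sum_distrib_left mult_ac flip: power_add
             del: power_add mult.assoc; simp)
      also have "\<dots> = sum ?t {(i, j). i + j < m}"
        by (rule sum.triangle_reindex[symmetric])
      finally have R: "?R z = sum ?t {(i, j). i + j < m}" .
      have "?P z * ?Q z = sum ?t ({..<m} \<times> {..<m})"
        by (simp only: sum_product sum.cartesian_product)
      then have eq: "?P z * ?Q z - ?R z = sum ?t ({..<m} \<times> {..<m} - {(i, j). i + j < m})"
        by (simp only: R sum_diff[OF _ sub] finite_cartesian_product finite_lessThan)
      show ?thesis
        unfolding eq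
      proof (rule nrm_sum_le)
        fix p assume "p \<in> {..<m} \<times> {..<m} - {(i, j). i + j < m}"
        then obtain i j where p: "p = (i, j)" "i < m" "j < m" "m \<le> i + j"
          by auto
        have "nrm (?t p) = nrm (fps_nth F i * fps_nth G j) * nrm z ^ (i + j)"
          by (simp add: p(1) nrm_mult nrm_power power_add)
        also have "\<dots> \<le> C5 * nrm z ^ m"
          using C5 p z1 by (intro mult_mono power_decreasing) auto
        finally show "nrm (?t p) \<le> C5 * nrm z ^ m" .
      qed (use C5 in auto)
    qed
    have "h z * k z - ?R z = ((h z - ?P z) * k z + ?P z * (k z - ?Q z)) + (?P z * ?Q z - ?R z)"
      by (simp add: algebra_simps)
    moreover have le: "D * nrm z ^ m \<le> C * nrm z ^ m" if "D \<le> C" for D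
      using that by (intro mult_right_mono) auto
    moreover have "C1 * C4 \<le> C" "max C1 C3 * C2 \<le> C" "C5 \<le> C"
      by (simp_all only: C_def max.cobounded1 max.cobounded2 max.coboundedI2)
    ultimately show ?thesis
      by (simp only:) (intro nrm_add_le order_trans[OF a le] order_trans[OF b le] order_trans[OF c le])
  qed
  moreover have "r > 0"
    using 1(2) 2(2) 3(2) 4(2) by (simp add: r_def)
  ultimately show "\<exists>C r. r > 0 \<and> (\<forall>z. z \<noteq> 0 \<and> nrm z < r \<longrightarrow> nrm (h z * k z - ?R z) \<le> C * nrm z ^ m)"
    by blast
qed

text \<open>If the lower coefficients agree, subtracting the two expansions of order n + 1 bounds
  the difference of the n-th coefficients by a constant times \<open>nrm z\<close>;
  \<open>small\<close> lets z tend to 0.\<close>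

lemma has_expansion_unique:
  assumes F: "has_expansion h F" and G: "has_expansion h G"
    and small: "\<And>e. e > 0 \<Longrightarrow> \<exists>z. z \<noteq> 0 \<and> nrm z < e"
  shows "F = G"
proof (rule fps_ext)
  fix n
  show "fps_nth F n = fps_nth G n"
  proof (induction n rule: less_induct)
    case (less n)
    obtain C1 r1 where 1: "C1 > 0" "r1 > 0" "r1 \<le> 1"
      "\<And>z. z \<noteq> 0 \<Longrightarrow> nrm z < r1 \<Longrightarrow> nrm (h z - (\<Sum>i<Suc n. fps_nth F i * z ^ i)) \<le> C1 * nrm z ^ Suc n"
      by (rule has_expansionD[OF F, where m = "Suc n"]) (rule that; assumption)
    obtain C2 r2 where 2: "C2 > 0" "r2 > 0" "r2 \<le> 1"
      "\<And>z. z \<noteq> 0 \<Longrightarrow> nrm z < r2 \<Longrightarrow> nrm (h z - (\<Sum>i<Suc n. fps_nth G i * z ^ i)) \<le> C2 * nrm z ^ Suc n"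
      by (rule has_expansionD[OF G, where m = "Suc n"]) (rule that; assumption)
    define d where "d = fps_nth F n - fps_nth G n"
    have bound: "nrm d \<le> max C1 C2 * nrm z" if z: "z \<noteq> 0" "nrm z < min r1 r2" for z
    proof -
      have "(\<Sum>i<n. fps_nth F i * z ^ i) = (\<Sum>i<n. fps_nth G i * z ^ i)"
        using less.IH by (intro sum.cong) auto
      then have eq: "d * z ^ n = (h z - (\<Sum>i<Suc n. fps_nth G i * z ^ i)) - (h z - (\<Sum>i<Suc n. fps_nth F i * z ^ i))"
        by (simp add: d_def algebra_simps)
      have zr: "nrm z < r1" "nrm z < r2"
        using z(2) by auto
      have le: "D * nrm z ^ Suc n \<le> max C1 C2 * nrm z ^ Suc n" if "D \<le> max C1 C2" for D
        using that by (intro mult_right_mono) auto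
      have "nrm (d * z ^ n) \<le> max C1 C2 * nrm z ^ Suc n"
        unfolding eq
        by (rule nrm_diff_le[OF order_trans[OF 2(4)[OF z(1) zr(2)] le] order_trans[OF 1(4)[OF z(1) zr(1)] le]]) simp_all
      then have "nrm d * nrm z ^ n \<le> (max C1 C2 * nrm z) * nrm z ^ n"
        by (simp add: nrm_mult nrm_power mult_ac)
      then show ?thesis
        by (rule mult_right_le_imp_le) (use z in simp)
    qed
    have "d = 0"
    proof (rule ccontr)
      assume d: "d \<noteq> 0"
      define e where "e = min (min r1 r2) (nrm d / max C1 C2)"
      have "e > 0"
        using d 1 2 by (simp add: e_def)
      then obtain z where z: "z \<noteq> 0" "nrm z < e"
        using small by blast
      then have "max C1 C2 * nrm z < nrm d"
        using 1(1) by (simp add: e_def pos_less_divide_eq mult.commute less_max_iff_disj)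
      then show False
        using bound[of z] z by (simp add: e_def)
    qed
    then show ?case
      by (simp add: d_def)
  qed
qed

end

section \<open>Finite fields\<close>

lemma two_le_card_field: "2 \<le> CARD('k::{field,finite})"
proof -
  have "card {0, 1 :: 'k} \<le> CARD('k)"
    by (rule card_mono) auto
  then show ?thesis
    by simp
qed

text \<open>Multiplication by a nonzero x permutes the nonzero elements, so the factor x^(q - 1)
  leaves their product unchanged.\<close>

lemma finite_field_power_card:
  fixes x :: "'k::{field,finite}"
  shows "x ^ CARD('k) = x"
proof (cases "x = 0")
  case False
  have "x ^ (CARD('k) - 1) * \<Prod>(UNIV - {0}) = (\<Prod>y\<in>UNIV - {0}. x * y)"
    by (simp add: prod.distrib)
  also have "\<dots> = \<Prod>(UNIV - {0})"
    by (rule prod.reindex_bij_witness[of _ "\<lambda>y. y / x" "\<lambda>y. x * y"]) (use False in auto)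
  finally have "x ^ (CARD('k) - 1) = 1"
    by simp
  then show ?thesis
    using power_minus_mult[of "CARD('k)" x] by simp
qed simp

text \<open>Compares coefficients of (1 + X)^q and X^q + 1: both are monic of degree q and they
  agree at all q elements of the field. This avoids writing q as a power of the
  characteristic.\<close>

lemma finite_field_choose_card:
  assumes "0 < i" "i < CARD('k::{field,finite})"
  shows "of_nat (CARD('k) choose i) = (0 :: 'k)"
proof -
  have "[:1, 1 :: 'k:] ^ CARD('k) = Polynomial.monom 1 CARD('k) + 1"
  proof (rule poly_eqI_degree_lead_coeff[where n = "CARD('k)" and A = UNIV])
    show "poly ([:1, 1:] ^ CARD('k)) z = poly (Polynomial.monom 1 CARD('k) + 1) z" for z :: 'k
      by (simp add: poly_power poly_monom finite_field_power_card)
    show "Polynomial.degree (Polynomial.monom (1::'k) CARD('k) + 1) \<le> CARD('k)"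
      by (intro degree_add_le) (simp_all add: degree_monom_eq)
    show "Polynomial.degree ([:1, 1 :: 'k:] ^ CARD('k)) \<le> CARD('k)"
      by (simp add: degree_power_eq)
  qed (simp_all add: coeff_linear_poly_power)
  from arg_cong[OF this, of "\<lambda>p. poly.coeff p i"] show ?thesis
    using assms by (simp add: coeff_linear_poly_power)
qed

section \<open>The field of Laurent series and its completed closure\<close>

definition absv :: "'c::{zero,metric_space} \<Rightarrow> real" where
  "absv x = dist x 0"

sublocale C_infinity \<subseteq> ultrametric_field "absv :: 'c \<Rightarrow> real"
proof
  show "dist u v = absv (u - v)" for u v :: 'c
    unfolding absv_def by (rule dist_eq)
  show "absv (u * v) = absv u * absv v" for u v :: 'c
    unfolding absv_def by (rule abs_mult)
  show "absv (u + v) \<le> max (absv u) (absv v)" for u v :: 'c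
    unfolding absv_def by (rule abs_add_le_max)
qed

lemma fls_subdegree_A_to_Kinf:
  assumes "a \<noteq> 0"
  shows "fls_subdegree (A_to_Kinf a) = - int (Polynomial.degree a)"
  by (rule fls_subdegree_eqI) (use assms in \<open>auto simp: A_to_Kinf_nth coeff_eq_0 nat_less_iff\<close>)

context C_infinity
begin

abbreviation em :: "'k poly \<Rightarrow> 'c" where
  "em \<equiv> A_embed \<iota>"

abbreviation cst :: "'k \<Rightarrow> 'c" where
  "cst c \<equiv> A_embed \<iota> [:c:]"

abbreviation T :: 'c where
  "T \<equiv> A_embed \<iota> [:0, 1:]"

lemma Kinf_embed_add: "Kinf_embed \<iota> (x + y) = Kinf_embed \<iota> x + Kinf_embed \<iota> y"
  by (simp add: Kinf_embed_def embed_add)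

lemma Kinf_embed_mult: "Kinf_embed \<iota> (x * y) = Kinf_embed \<iota> x * Kinf_embed \<iota> y"
  by (simp add: Kinf_embed_def embed_mult)

lemma Kinf_embed_1 [simp]: "Kinf_embed \<iota> 1 = 1"
  by (simp add: Kinf_embed_def embed_one)

lemma Kinf_embed_0 [simp]: "Kinf_embed \<iota> 0 = 0"
  using Kinf_embed_add[of 0 0] by (metis add_cancel_right_right add_0)

lemma Kinf_embed_minus: "Kinf_embed \<iota> (- x) = - Kinf_embed \<iota> x"
  using Kinf_embed_add[of x "- x"] by (simp add: eq_neg_iff_add_eq_0 add.commute)

lemma Kinf_embed_diff: "Kinf_embed \<iota> (x - y) = Kinf_embed \<iota> x - Kinf_embed \<iota> y"
  using Kinf_embed_add[of x "- y"] by (simp add: Kinf_embed_minus)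

lemma absv_Kinf_embed: "absv (Kinf_embed \<iota> f) = abs_Kinf f"
  by (simp add: absv_def Kinf_embed_def abs_embed)

lemma Kinf_embed_eq_0_iff [simp]: "Kinf_embed \<iota> x = 0 \<longleftrightarrow> x = 0"
proof
  assume "Kinf_embed \<iota> x = 0"
  then have "abs_Kinf x = 0"
    using absv_Kinf_embed[of x] by simp
  then show "x = 0"
    by (simp add: abs_Kinf_def split: if_splits)
qed simp

lemma Kinf_embed_inverse: "Kinf_embed \<iota> (inverse x) = inverse (Kinf_embed \<iota> x)"
proof (cases "x = 0")
  case False
  then show ?thesis
    using Kinf_embed_mult[of x "inverse x"] by (simp add: inverse_unique)
qed simp

lemma Kinf_embed_divide: "Kinf_embed \<iota> (x / y) = Kinf_embed \<iota> x / Kinf_embed \<iota> y"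
  by (simp only: divide_inverse Kinf_embed_mult Kinf_embed_inverse)

lemma em_0 [simp]: "em 0 = 0"
  by (simp add: A_embed_def)

lemma em_1 [simp]: "em 1 = 1"
  by (simp add: A_embed_def)

lemma em_add: "em (a + b) = em a + em b"
  by (simp add: A_embed_def A_to_Kinf_add Kinf_embed_add)

lemma em_mult: "em (a * b) = em a * em b"
  by (simp add: A_embed_def A_to_Kinf_mult Kinf_embed_mult)

lemma em_minus: "em (- a) = - em a"
  using em_add[of a "- a"] by (simp add: eq_neg_iff_add_eq_0 add.commute)

lemma em_diff: "em (a - b) = em a - em b"
  using em_add[of a "- b"] by (simp add: em_minus)

lemma em_power: "em (a ^ n) = em a ^ n"
  by (induction n) (simp_all add: em_mult)

lemma em_eq_0_iff [simp]: "em a = 0 \<longleftrightarrow> a = 0"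
  by (simp add: A_embed_def)

lemma em_eq_iff: "em a = em b \<longleftrightarrow> a = b"
  using em_diff[of a b] em_eq_0_iff[of "a - b"] by auto

lemma em_of_nat: "em (of_nat n) = of_nat n"
  by (induction n) (simp_all add: em_add)

lemma em_pCons: "em (pCons c a) = cst c + T * em a"
proof -
  have "pCons c a = [:c:] + [:0, 1:] * a"
    by simp
  then show ?thesis
    by (simp only: em_add em_mult)
qed

lemma absv_em: "a \<noteq> 0 \<Longrightarrow> absv (em a) = real CARD('k) ^ Polynomial.degree a"
  by (simp add: A_embed_def absv_Kinf_embed abs_Kinf_def fls_subdegree_A_to_Kinf)

lemma one_le_absv_em: "a \<noteq> 0 \<Longrightarrow> 1 \<le> absv (em a)"
  using two_le_card_field[where 'k = 'k] by (simp add: absv_em)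

lemma absv_T: "absv T = real CARD('k)"
  by (simp add: absv_em)

lemma T_nonzero [simp]: "T \<noteq> 0"
  by simp

lemma cst_power_card: "cst c ^ CARD('k) = cst c"
  by (simp add: poly_const_pow finite_field_power_card flip: em_power)

lemma of_nat_em_eq_0: "of_nat n = (0 :: 'k) \<Longrightarrow> of_nat n = (0 :: 'c)"
  using em_of_nat[of n] by (simp add: of_nat_poly)

lemma of_nat_choose_card: "0 < i \<Longrightarrow> i < CARD('k) \<Longrightarrow> of_nat (CARD('k) choose i) = (0 :: 'c)"
  by (simp add: of_nat_em_eq_0 finite_field_choose_card)

lemma of_nat_card: "of_nat CARD('k) = (0 :: 'c)"
  using of_nat_choose_card[of 1] two_le_card_field[where 'k = 'k] by simp

section \<open>Additivity of the q-th power map and partial fractions over the finite field\<close>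

lemma frobenius_add: "(x + y) ^ CARD('k) = x ^ CARD('k) + y ^ CARD('k)" for x y :: 'c
proof -
  have "(x + y) ^ CARD('k)
      = (\<Sum>i\<le>CARD('k). of_nat (CARD('k) choose i) * x ^ i * y ^ (CARD('k) - i))"
    by (rule binomial_ring)
  also have "\<dots> = (\<Sum>i\<in>{0, CARD('k)}. of_nat (CARD('k) choose i) * x ^ i * y ^ (CARD('k) - i))"
    by (rule sum.mono_neutral_right) (auto simp: of_nat_choose_card)
  finally show ?thesis
    by simp
qed

lemma frobenius_diff: "(x - y) ^ CARD('k) = x ^ CARD('k) - y ^ CARD('k)" for x y :: 'c
  using frobenius_add[of "x - y" y] by simp

text \<open>For l \<noteq> 0 both sides are monic of degree q and vanish at the q distinct multiples
  c l, since c^q = c. For l = 0 these points coincide, hence the case distinction.\<close>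

lemma prod_linear_cst:
  "(\<Prod>c\<in>UNIV. [:- (cst c * l), 1:]) = Polynomial.monom 1 CARD('k) - Polynomial.monom (l ^ (CARD('k) - 1)) 1"
  (is "?P = ?Q")
proof (cases "l = 0")
  case True
  then show ?thesis
    using two_le_card_field[where 'k = 'k] by (simp add: monom_altdef power_0_left)
next
  case False
  let ?A = "range (\<lambda>c. cst c * l)"
  have degP: "Polynomial.degree ?P = CARD('k)"
    by (subst degree_prod_eq_sum_degree) simp_all
  have coeff: "poly.coeff ?P CARD('k) = 1"
    using lead_coeff_prod[of "\<lambda>c. [:- (cst c * l), 1:]" UNIV] by (simp add: degP)
  have inj: "inj (\<lambda>c. cst c * l)"
    using False by (auto simp: inj_on_def em_eq_iff)
  show ?thesis
  proof (rule poly_eqI_degree_lead_coeff[where n = "CARD('k)" and A = ?A])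
    show "poly.coeff ?P CARD('k) = poly.coeff ?Q CARD('k)"
      using two_le_card_field[where 'k = 'k] by (simp add: coeff)
    show "CARD('k) \<le> card ?A"
      by (simp add: card_image inj)
    show "Polynomial.degree ?Q \<le> CARD('k)"
      using two_le_card_field[where 'k = 'k]
      by (intro degree_diff_le) (auto intro!: order_trans[OF degree_monom_le])
    fix z assume "z \<in> ?A"
    then obtain c where z: "z = cst c * l"
      by blast
    have "poly ?P z = 0"
      by (auto simp: poly_prod z)
    moreover have "l ^ (CARD('k) - 1) * l = l ^ CARD('k)"
      by (rule power_minus_mult) simp
    then have "poly ?Q z = 0"
      by (simp add: z poly_monom power_mult_distrib cst_power_card algebra_simps)
    ultimately show "poly ?P z = poly ?Q z"
      by simp
  qed (simp add: degP)
qed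

lemma prod_minus_cst: "(\<Prod>c\<in>UNIV. x - cst c * l) = x ^ CARD('k) - l ^ (CARD('k) - 1) * x"
  using arg_cong[OF prod_linear_cst[of l], of "\<lambda>p. poly p x"] by (simp add: poly_prod poly_monom)

lemma minus_cst_nonzero:
  assumes "x ^ CARD('k) - l ^ (CARD('k) - 1) * x \<noteq> 0"
  shows "x - cst c * l \<noteq> 0"
proof
  assume "x - cst c * l = 0"
  then have "(\<Prod>c\<in>UNIV. x - cst c * l) = 0"
    by (intro prod_zero) auto
  with assms show False
    by (simp only: prod_minus_cst)
qed

text \<open>Logarithmic derivative of \<open>prod_linear_cst\<close>: the derivative of X^q vanishes
  because q is zero in the field, so only the constant -l^(q - 1) remains as numerator.\<close>

lemma sum_inverse_linear_cst:
  assumes "x ^ CARD('k) - l ^ (CARD('k) - 1) * x \<noteq> 0"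
  shows "(\<Sum>c\<in>UNIV. 1 / (x - cst c * l)) = - (l ^ (CARD('k) - 1)) / (x ^ CARD('k) - l ^ (CARD('k) - 1) * x)"
proof -
  let ?f = "\<lambda>c. [:- (cst c * l), 1:]"
  note nz = minus_cst_nonzero[OF assms]
  have "(\<Sum>c\<in>UNIV. 1 / (x - cst c * l)) * (\<Prod>c\<in>UNIV. x - cst c * l)
      = (\<Sum>c\<in>UNIV. \<Prod>b\<in>UNIV - {c}. x - cst b * l)"
    unfolding sum_distrib_right
  proof (intro sum.cong refl)
    fix c :: 'k
    show "1 / (x - cst c * l) * (\<Prod>c\<in>UNIV. x - cst c * l) = (\<Prod>b\<in>UNIV - {c}. x - cst b * l)"
      using prod.remove[of UNIV c "\<lambda>c. x - cst c * l"] nz[of c] by simp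
  qed
  also have "\<dots> = poly (pderiv (prod ?f UNIV)) x"
    by (simp add: pderiv_prod poly_sum poly_prod pderiv_pCons)
  also have "\<dots> = - (l ^ (CARD('k) - 1))"
    by (simp add: prod_linear_cst pderiv_diff pderiv_monom of_nat_card poly_monom)
  finally show ?thesis
    unfolding prod_minus_cst by (subst eq_divide_eq) (simp only: assms not_False_eq_True if_True)
qed

end

section \<open>The Carlitz exponential\<close>

lemma carlitz_D_0 [simp]: "carlitz_D 0 = 1"
  by (simp add: carlitz_D_def)

lemma carlitz_D_Suc:
  "carlitz_D (Suc i) = carlitz_bracket (Suc i) * (carlitz_D i :: 'k::{field,finite} poly) ^ CARD('k)"
proof -
  have "(\<Prod>k=1..i. carlitz_bracket k ^ (CARD('k) ^ (Suc i - k)))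
      = (\<Prod>k=1..i. (carlitz_bracket k ^ (CARD('k) ^ (i - k))) ^ CARD('k) :: 'k poly)"
    by (intro prod.cong refl) (simp add: Suc_diff_le mult.commute flip: power_mult)
  then show ?thesis
    by (simp add: carlitz_D_def prod_power_distrib mult.commute)
qed

context C_infinity
begin

abbreviation e :: "'c \<Rightarrow> 'c" where
  "e \<equiv> carlitz_exp \<iota>"

definition carlitz_term :: "'c \<Rightarrow> nat \<Rightarrow> 'c" where
  "carlitz_term z i = z ^ (CARD('k) ^ i) / em (carlitz_D i)"

lemma carlitz_exp_eq: "e z = (\<Sum>i. carlitz_term z i)"
  by (simp add: carlitz_exp_def carlitz_term_def)

lemma em_carlitz_bracket: "em (carlitz_bracket i) = T ^ (CARD('k) ^ i) - T"
proof -
  have "Polynomial.monom 1 n = [:0, 1 :: 'k:] ^ n" for n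
    by (simp add: monom_altdef)
  then show ?thesis
    by (simp add: carlitz_bracket_def em_diff em_power)
qed

lemma absv_carlitz_bracket:
  assumes "i > 0"
  shows "absv (em (carlitz_bracket i)) = real CARD('k) ^ (CARD('k) ^ i)"
proof -
  have "CARD('k) ^ 1 \<le> CARD('k) ^ i"
    using assms two_le_card_field[where 'k = 'k] by (intro power_increasing) auto
  then have "real CARD('k) ^ 1 < real CARD('k) ^ (CARD('k) ^ i)"
    using two_le_card_field[where 'k = 'k] by (intro power_strict_increasing) auto
  then show ?thesis
    by (simp add: em_carlitz_bracket nrm_diff_eq nrm_power absv_T)
qed

lemma em_carlitz_D_Suc: "em (carlitz_D (Suc i)) = em (carlitz_bracket (Suc i)) * em (carlitz_D i) ^ CARD('k)"
  by (simp only: carlitz_D_Suc em_mult em_power)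

lemma carlitz_D_nonzero [simp]: "carlitz_D i \<noteq> (0 :: 'k poly)"
proof (induction i)
  case (Suc i)
  have "absv (em (carlitz_bracket (Suc i))) \<noteq> 0"
    by (subst absv_carlitz_bracket) simp_all
  with Suc show ?case
    by (simp add: carlitz_D_Suc)
qed simp

lemma carlitz_term_0 [simp]: "carlitz_term z 0 = z"
  by (simp add: carlitz_term_def)

lemma carlitz_term_Suc: "carlitz_term z (Suc i) = carlitz_term z i ^ CARD('k) / em (carlitz_bracket (Suc i))"
  by (simp add: carlitz_term_def em_carlitz_D_Suc power_divide mult.commute flip: power_mult)

lemma absv_carlitz_term_Suc:
  "absv (carlitz_term z (Suc i)) = absv (carlitz_term z i) ^ CARD('k) / real CARD('k) ^ (CARD('k) ^ Suc i)"
  by (simp add: carlitz_term_Suc nrm_divide nrm_power absv_carlitz_bracket)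

text \<open>The bracket [i] has absolute value q^(q^i), so D_i has absolute value q^(i q^i). The
  base \<bar>z\<bar> / q^i eventually drops below 1, which makes the series converge for every
  z.\<close>

lemma absv_carlitz_term:
  "absv (carlitz_term z i) = (absv z / real CARD('k) ^ i) ^ (CARD('k) ^ i)"
proof (induction i)
  case (Suc i)
  show ?case
    unfolding absv_carlitz_term_Suc Suc.IH power_Suc2[of _ i] times_divide_eq_right
    by (simp only: power_mult[symmetric] power_divide[symmetric] divide_divide_eq_left)
qed simp

lemma frobenius_pow_add: "(x + y) ^ (CARD('k) ^ i) = x ^ (CARD('k) ^ i) + y ^ (CARD('k) ^ i)" for x y :: 'c
  by (induction i) (simp_all add: power_mult mult.commute[of "CARD('k)"] frobenius_add)

lemma carlitz_term_add: "carlitz_term (y + z) i = carlitz_term y i + carlitz_term z i"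
  by (simp add: carlitz_term_def frobenius_pow_add add_divide_distrib)

lemma carlitz_term_cst: "carlitz_term (cst c * z) i = cst c * carlitz_term z i"
proof -
  have "cst c ^ (CARD('k) ^ i) = cst c"
    by (induction i) (simp_all add: power_mult mult.commute[of "CARD('k)"] cst_power_card)
  then show ?thesis
    by (simp add: carlitz_term_def power_mult_distrib)
qed

lemma null_on_carlitz_term: "null_on (carlitz_term z) UNIV"
  unfolding null_on_def
proof (intro allI impI)
  fix r :: real assume r: "r > 0"
  have q: "2 \<le> real CARD('k)"
    using two_le_card_field[where 'k = 'k] by simp
  then obtain n where "absv z / min r 1 < real CARD('k) ^ n"
    using real_arch_pow[of "real CARD('k)"] by fastforce
  then have n: "absv z < min r 1 * real CARD('k) ^ n"
    using r by (simp add: divide_less_eq mult.commute)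
  have "absv (carlitz_term z i) < r" if "n \<le> i" for i
  proof -
    have "real CARD('k) ^ n \<le> real CARD('k) ^ i"
      using q that by (intro power_increasing) auto
    then have "min r 1 * real CARD('k) ^ n \<le> min r 1 * real CARD('k) ^ i"
      using r by (intro mult_left_mono) auto
    with n have y: "absv z / real CARD('k) ^ i < min r 1"
      using q by (subst pos_divide_less_eq) auto
    have "(absv z / real CARD('k) ^ i) ^ (CARD('k) ^ i) \<le> (absv z / real CARD('k) ^ i) ^ 1"
      using y by (intro power_decreasing) (auto simp: Suc_le_eq)
    then show ?thesis
      using y by (simp add: absv_carlitz_term)
  qed
  then have "{i \<in> UNIV. r \<le> absv (carlitz_term z i)} \<subseteq> {..<n}"
    by (metis (no_types, lifting) lessThan_iff linorder_not_le mem_Collect_eq subsetI)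
  then show "finite {i \<in> UNIV. r \<le> absv (carlitz_term z i)}"
    by (rule finite_subset) simp
qed

lemma has_sum_carlitz_term: "(carlitz_term z has_sum e z) UNIV"
proof -
  obtain S where S: "(carlitz_term z has_sum S) UNIV"
    by (rule has_sum_null_onE[OF null_on_carlitz_term])
  then have "e z = S"
    unfolding carlitz_exp_eq by (rule sums_unique[symmetric, OF has_sum_sums_nrm])
  with S show ?thesis
    by simp
qed

lemma carlitz_exp_limit: "(\<lambda>n. \<Sum>i<n. carlitz_term z i) \<longlonglongrightarrow> e z"
  using has_sum_sums_nrm[OF has_sum_carlitz_term] by (simp add: sums_def)

lemma carlitz_exp_add: "e (y + z) = e y + e z"
proof (rule has_sum_unique_nrm)
  show "(carlitz_term (y + z) has_sum e y + e z) UNIV"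
    unfolding carlitz_term_add[abs_def] by (intro has_sum_add_nrm has_sum_carlitz_term)
qed (rule has_sum_carlitz_term)

lemma carlitz_exp_cst: "e (cst c * z) = cst c * e z"
proof (rule has_sum_unique_nrm)
  show "(carlitz_term (cst c * z) has_sum cst c * e z) UNIV"
    unfolding carlitz_term_cst[abs_def] by (intro has_sum_cmult_nrm has_sum_carlitz_term)
qed (rule has_sum_carlitz_term)

lemma carlitz_exp_0 [simp]: "e 0 = 0"
  using carlitz_exp_add[of 0 0] by (metis add_cancel_right_right add_0)

lemma carlitz_exp_diff: "e (y - z) = e y - e z"
  using carlitz_exp_add[of "y - z" z] by simp

text \<open>Termwise T^(q^i) = T + [i]: the part with [i] is the q-th power of the preceding term,
  as D_i = [i] D_(i-1)^q. Therefore the second sum on the right stops one index earlier.\<close>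

lemma partial_carlitz_exp_T:
  "(\<Sum>i<Suc n. carlitz_term (T * z) i)
    = T * (\<Sum>i<Suc n. carlitz_term z i) + (\<Sum>i<n. carlitz_term z i) ^ CARD('k)"
proof (induction n)
  case (Suc n)
  have "em (carlitz_bracket (Suc n)) \<noteq> 0"
    using absv_carlitz_bracket[of "Suc n"] by (metis nrm_0 of_nat_eq_0_iff power_eq_0_iff zero_less_Suc zero_less_card_finite less_numeral_extra(3))
  then have "carlitz_term z n ^ CARD('k) = em (carlitz_bracket (Suc n)) * carlitz_term z (Suc n)"
    by (simp add: carlitz_term_Suc)
  moreover have "carlitz_term (T * z) (Suc n) = T ^ (CARD('k) ^ Suc n) * carlitz_term z (Suc n)"
    by (simp add: carlitz_term_def power_mult_distrib)
  ultimately have "carlitz_term (T * z) (Suc n) = T * carlitz_term z (Suc n) + carlitz_term z n ^ CARD('k)"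
    by (simp add: em_carlitz_bracket algebra_simps)
  then show ?case
    using Suc.IH
    by (simp only: sum.lessThan_Suc[of _ "Suc n"] sum.lessThan_Suc[of _ n] frobenius_add distrib_left) 
       (simp add: algebra_simps)
qed simp

lemma carlitz_exp_T: "e (T * z) = T * e z + e z ^ CARD('k)"
proof (rule LIMSEQ_unique)
  let ?s = "\<lambda>n. \<Sum>i<n. carlitz_term z i"
  show "(\<lambda>n. \<Sum>i<Suc n. carlitz_term (T * z) i) \<longlonglongrightarrow> e (T * z)"
    using LIMSEQ_Suc[OF carlitz_exp_limit] .
  have lim: "(\<lambda>n. absv (?s n - e z)) \<longlonglongrightarrow> 0"
    using carlitz_exp_limit[of z] unfolding tendsto_nrm_iff .
  have "(\<lambda>n. real CARD('k) * absv (?s (Suc n) - e z) + absv (?s n - e z) ^ CARD('k)) \<longlonglongrightarrow>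
      real CARD('k) * 0 + 0 ^ CARD('k)"
    by (intro tendsto_intros lim LIMSEQ_Suc[OF lim])
  then have lim0: "(\<lambda>n. real CARD('k) * absv (?s (Suc n) - e z) + absv (?s n - e z) ^ CARD('k)) \<longlonglongrightarrow> 0"
    by (simp add: power_0_left)
  have le: "absv ((\<Sum>i<Suc n. carlitz_term (T * z) i) - (T * e z + e z ^ CARD('k)))
      \<le> real CARD('k) * absv (?s (Suc n) - e z) + absv (?s n - e z) ^ CARD('k)" for n
  proof -
    have eq: "(\<Sum>i<Suc n. carlitz_term (T * z) i) - (T * e z + e z ^ CARD('k))
        = T * (?s (Suc n) - e z) + (?s n - e z) ^ CARD('k)"
      unfolding partial_carlitz_exp_T frobenius_diff by (simp only: right_diff_distrib add_diff_eq diff_diff_eq2 diff_add_eq)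
         (simp add: algebra_simps)
    show ?thesis
      unfolding eq by (rule nrm_add_le) (simp_all add: nrm_mult nrm_power absv_T)
  qed
  have "(\<lambda>n. absv ((\<Sum>i<Suc n. carlitz_term (T * z) i) - (T * e z + e z ^ CARD('k)))) \<longlonglongrightarrow> 0"
    by (rule real_tendsto_sandwich[OF _ always_eventually[OF allI[OF le]] tendsto_const lim0]) simp
  then show "(\<lambda>n. \<Sum>i<Suc n. carlitz_term (T * z) i) \<longlonglongrightarrow> T * e z + e z ^ CARD('k)"
    unfolding tendsto_nrm_iff[where f = "\<lambda>n. \<Sum>i<Suc n. carlitz_term (T * z) i"] .
qed

section \<open>Size of the exponential near the origin and existence of a nonzero zero\<close>

lemma card_power_pred: "x ^ CARD('k) = x ^ (CARD('k) - 1) * x" for x :: "'a::monoid_mult"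
  by (rule power_minus_mult[symmetric]) simp

text \<open>The term of index 1 has absolute value \<bar>z\<bar>^q / q^q because \<bar>D_1\<bar> =
  q^q. The hypothesis makes this at most \<bar>z\<bar>, and the recursion for the terms then keeps
  all later ones below it.\<close>

lemma absv_carlitz_term_le:
  assumes z: "absv z ^ (CARD('k) - 1) \<le> real CARD('k) ^ CARD('k)"
  shows "absv (carlitz_term z (Suc i)) \<le> absv z ^ CARD('k) / real CARD('k) ^ CARD('k)"
proof (induction i)
  case 0
  show ?case
    by (simp add: absv_carlitz_term_Suc)
next
  case (Suc i)
  let ?q = "CARD('k)" and ?u = "absv z ^ CARD('k) / real CARD('k) ^ CARD('k)"
  have q: "2 \<le> ?q"
    by (rule two_le_card_field)
  have u: "0 \<le> ?u" "?u \<le> absv z"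
  proof -
    have "absv z ^ (?q - 1) * absv z \<le> real ?q ^ ?q * absv z"
      by (rule mult_right_mono[OF z]) simp
    then show "?u \<le> absv z"
      using q by (simp add: card_power_pred[of "absv z"] divide_le_eq mult.commute)
  qed simp
  have "?u ^ (?q - 1) \<le> absv z ^ (?q - 1)"
    by (rule power_mono[OF u(2,1)])
  also have "\<dots> \<le> real ?q ^ ?q"
    by (rule z)
  also have "\<dots> \<le> real ?q ^ (?q ^ Suc (Suc i))"
    using q by (intro power_increasing) auto
  finally have "?u ^ (?q - 1) * ?u \<le> real ?q ^ (?q ^ Suc (Suc i)) * ?u"
    by (rule mult_right_mono[OF _ u(1)])
  then have "?u ^ ?q / real ?q ^ (?q ^ Suc (Suc i)) \<le> ?u"
    using q by (subst pos_divide_le_eq) (simp_all only: card_power_pred[of ?u] mult.commute, simp)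
  moreover have "absv (carlitz_term z (Suc i)) ^ ?q \<le> ?u ^ ?q"
    using Suc.IH by (intro power_mono) auto
  then have "absv (carlitz_term z (Suc (Suc i))) \<le> ?u ^ ?q / real ?q ^ (?q ^ Suc (Suc i))"
    unfolding absv_carlitz_term_Suc[of z "Suc i"] by (intro divide_right_mono) auto
  ultimately show ?case
    by (rule order_trans[rotated])
qed

lemma absv_carlitz_exp_diff_le:
  assumes "absv z ^ (CARD('k) - 1) \<le> real CARD('k) ^ CARD('k)"
  shows "absv (e z - z) \<le> absv z ^ CARD('k) / real CARD('k) ^ CARD('k)"
proof (cases "z = 0")
  case False
  have "absv (sum (carlitz_term z) {0} - e z) \<le> absv z ^ CARD('k) / real CARD('k) ^ CARD('k)"
  proof (rule has_sum_approx[OF has_sum_carlitz_term])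
    fix i :: nat assume "i \<in> UNIV - {0}"
    then obtain j where "i = Suc j"
      by (cases i) auto
    then show "absv (carlitz_term z i) \<le> absv z ^ CARD('k) / real CARD('k) ^ CARD('k)"
      using absv_carlitz_term_le[OF assms] by simp
  qed (use False in auto)
  then show ?thesis
    by (simp add: nrm_minus_commute)
qed simp

text \<open>For nonzero z the strict inequality makes the term of index 1 strictly smaller than z,
  so the linear term dominates the whole series.\<close>

lemma absv_carlitz_exp_eq:
  assumes "absv z ^ (CARD('k) - 1) < real CARD('k) ^ CARD('k)"
  shows "absv (e z) = absv z"
proof (cases "z = 0")
  case False
  have "absv z ^ CARD('k) < real CARD('k) ^ CARD('k) * absv z"
    unfolding card_power_pred[of "absv z"] using assms False by (intro mult_strict_right_mono) auto
  then have "absv z ^ CARD('k) / real CARD('k) ^ CARD('k) < absv z"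
    by (subst pos_divide_less_eq) (auto simp: mult.commute)
  then have "absv (e z - z) < absv z"
    using absv_carlitz_exp_diff_le[of z] assms by simp
  then show ?thesis
    using nrm_add_eq[of "e z - z" z] by simp
qed simp

text \<open>
  A root \<open>l\<close> of \<open>T l + l\<^sup>q = 0\<close> exists already in the algebraic closure. Since \<open>e\<close> is a contractive
  perturbation of the identity near 0, \<open>l = e(z)\<close> for some \<open>z\<close>, and then \<open>e(T z) = 0\<close>.
\<close>

lemma carlitz_exp_nonzero_root:
  obtains z where "z \<noteq> 0" "e z = 0" "absv z ^ (CARD('k) - 1) \<le> real CARD('k) ^ CARD('k)"
proof -
  let ?q = "CARD('k)"
  have q: "2 \<le> ?q"
    by (rule two_le_card_field)
  obtain y :: "'k fls alg_closure" where y: "y ^ (?q - 1) = to_ac (A_to_Kinf (- [:0, 1:]))"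
    using nth_root_exists[of "?q - 1"] q by fastforce
  define l where "l = \<iota> y"
  have "\<iota> (y ^ n) = \<iota> y ^ n" for n
    by (induction n) (simp_all add: embed_one embed_mult)
  then have l: "l ^ (?q - 1) = - T"
    by (metis A_embed_def Kinf_embed_def em_minus l_def y)
  have absv_l: "absv l ^ (?q - 1) = real ?q"
    using arg_cong[OF l, of absv] by (simp add: nrm_power absv_T)
  have small: "absv z ^ (?q - 1) \<le> real ?q" if "absv z \<le> absv l" for z :: 'c
    using power_mono[OF that, of "?q - 1"] absv_l by simp
  have qq: "2 * real ?q \<le> real ?q ^ ?q"
  proof -
    have "2 * real ?q \<le> real ?q ^ 2"
      using q by (simp add: power2_eq_square)
    also have "\<dots> \<le> real ?q ^ ?q"
      using q by (intro power_increasing) auto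
    finally show ?thesis .
  qed
  \<comment> \<open>The contraction constant 1 / 2 comes from \<open>qq\<close>: \<bar>z\<bar>^(q -
    1) is at most q, and q / q^q \<le> 1 / 2.\<close>
  have contr: "absv (e z - z) \<le> 1 / 2 * absv z" if "absv z \<le> absv l" for z :: 'c
  proof -
    have "absv z ^ (?q - 1) * absv z \<le> real ?q * absv z"
      by (rule mult_right_mono[OF small[OF that]]) simp
    also have "\<dots> \<le> 1 / 2 * real ?q ^ ?q * absv z"
      by (rule mult_right_mono) (use qq in auto)
    finally have "absv z ^ ?q / real ?q ^ ?q \<le> 1 / 2 * absv z"
      using q by (simp add: card_power_pred[of "absv z"] divide_le_eq mult_ac)
    moreover have "absv (e z - z) \<le> absv z ^ ?q / real ?q ^ ?q"
      using small[OF that] qq by (intro absv_carlitz_exp_diff_le) linarith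
    ultimately show ?thesis
      by linarith
  qed
  define S where "S = {z :: 'c. absv z \<le> absv l}"
  have S: "S = cball 0 (absv l)"
    by (auto simp: S_def absv_def dist_commute)
  \<comment> \<open>A fixed point of this map solves e(z) = l. By additivity of e,
    \<open>contr\<close> for x - y is the contraction estimate; for z itself it keeps the ball
    invariant.\<close>
  have "\<exists>!z\<in>S. l - (e z - z) = z"
  proof (rule Banach_fix[where c = "1 / 2"])
    show "complete S"
      unfolding S by (simp add: complete_eq_closed)
    show "S \<noteq> {}"
      by (auto simp: S_def)
    show "(\<lambda>z. l - (e z - z)) ` S \<subseteq> S"
    proof
      fix w assume "w \<in> (\<lambda>z. l - (e z - z)) ` S"
      then obtain z where z: "absv z \<le> absv l" "w = l - (e z - z)"
        by (auto simp: S_def)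
      have "absv (e z - z) \<le> absv l"
        using contr[OF z(1)] z(1) nrm_nonneg[of z] by linarith
      then show "w \<in> S"
        unfolding S_def z(2) mem_Collect_eq by (rule nrm_diff_le[OF order_refl])
    qed
    fix x y assume xy: "x \<in> S" "y \<in> S"
    have "absv (x - y) \<le> absv l"
      using xy by (intro nrm_diff_le) (auto simp: S_def)
    from contr[OF this] show "dist (l - (e x - x)) (l - (e y - y)) \<le> 1 / 2 * dist x y"
      unfolding dist_nrm by (subst nrm_minus_commute) (simp add: carlitz_exp_diff algebra_simps)
  qed simp_all
  then obtain z where z: "absv z \<le> absv l" "l - (e z - z) = z"
    by (auto simp: S_def)
  have ez: "e z = l"
    using z(2) by (simp add: algebra_simps)
  have "l \<noteq> 0"
    using absv_l q by (auto simp: power_0_left)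
  with ez have "z \<noteq> 0"
    by auto
  show ?thesis
  proof (rule that[of "T * z"])
    show "T * z \<noteq> 0"
      using \<open>z \<noteq> 0\<close> by simp
    have "e (T * z) = T * l + l ^ (?q - 1) * l"
      unfolding carlitz_exp_T ez card_power_pred[of l] ..
    then show "e (T * z) = 0"
      by (simp only: l) simp
    have "absv (T * z) ^ (?q - 1) = real ?q ^ (?q - 1) * absv z ^ (?q - 1)"
      by (simp add: nrm_mult absv_T power_mult_distrib)
    also have "\<dots> \<le> real ?q ^ (?q - 1) * real ?q"
      by (rule mult_left_mono[OF small[OF z(1)]]) simp
    also have "\<dots> = real ?q ^ ?q"
      by (rule card_power_pred[symmetric])
    finally show "absv (T * z) ^ (?q - 1) \<le> real ?q ^ ?q" .
  qed
qed

end

section \<open>The period lattice\<close>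

locale carlitz_period = C_infinity \<iota>
  for \<iota> :: "'k::{field,finite} fls alg_closure \<Rightarrow> 'c::{field,complete_space}" +
  fixes w :: 'c
  assumes period: "fundamental_period \<iota> w"
begin

text \<open>Since e is additive, its periods are exactly its zeros.\<close>

lemma carlitz_exp_eq_0_iff: "e z = 0 \<longleftrightarrow> (\<exists>a. z = w * em a)"
proof -
  have "e z = 0 \<longleftrightarrow> z \<in> {\<mu>. \<forall>x. e (x + \<mu>) = e x}"
    by (simp add: carlitz_exp_add)
  also have "\<dots> \<longleftrightarrow> (\<exists>a. z = w * em a)"
    using period unfolding fundamental_period_def by auto
  finally show ?thesis .
qed

lemma carlitz_exp_lattice [simp]: "e (w * em a) = 0"
  by (rule carlitz_exp_eq_0_iff[THEN iffD2], rule exI, rule refl)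

text \<open>For w = 0 the set of periods would be {0}, which the nonzero zero of e excludes.\<close>

lemma w_nonzero [simp]: "w \<noteq> 0"
proof -
  obtain z where z: "z \<noteq> 0" "e z = 0"
    by (rule carlitz_exp_nonzero_root) (rule that; assumption)
  then obtain a where "z = w * em a"
    using carlitz_exp_eq_0_iff by blast
  with z show ?thesis
    by auto
qed

text \<open>The constructed zero is a multiple w a with \<bar>a\<bar> \<ge> 1, so its bound passes
  to w. Conversely, a smaller w would lie in the ball where e preserves absolute values, against
  e(w) = 0.\<close>

lemma absv_w: "absv w ^ (CARD('k) - 1) = real CARD('k) ^ CARD('k)"
proof (rule order.antisym)
  obtain z where z: "z \<noteq> 0" "e z = 0" "absv z ^ (CARD('k) - 1) \<le> real CARD('k) ^ CARD('k)"
    by (rule carlitz_exp_nonzero_root) (rule that; assumption)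
  obtain a where a: "z = w * em a"
    using z(2) unfolding carlitz_exp_eq_0_iff by (elim exE)
  have "1 \<le> absv (em a)"
    by (rule one_le_absv_em) (use z(1) in \<open>auto simp: a\<close>)
  then have "absv w \<le> absv z"
    using mult_left_mono[of 1 "absv (em a)" "absv w"] by (simp add: a nrm_mult)
  then show "absv w ^ (CARD('k) - 1) \<le> real CARD('k) ^ CARD('k)"
    using z(3) power_mono[of "absv w" "absv z" "CARD('k) - 1"] by simp
  show "real CARD('k) ^ CARD('k) \<le> absv w ^ (CARD('k) - 1)"
  proof (rule ccontr)
    assume "\<not> ?thesis"
    then have "absv (e w) = absv w"
      by (intro absv_carlitz_exp_eq) simp
    moreover have "e w = 0"
      using carlitz_exp_lattice[of 1] by simp
    ultimately show False
      by (simp only: nrm_0) (metis nrm_eq_0_iff w_nonzero)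
  qed
qed

end

subsection \<open>Partial fractions of the reciprocal of the exponential\<close>

text \<open>Polynomials of degree less than d, with 0 included also for d = 0; a condition on
  \<open>degree\<close> would exclude it there.\<close>

definition polys_below :: "nat \<Rightarrow> 'k::{field,finite} poly set" where
  "polys_below d = {b. \<forall>n\<ge>d. poly.coeff b n = 0}"

lemma polys_below_0: "polys_below 0 = {0}"
  by (auto simp: polys_below_def poly_eq_iff)

lemma polys_below_Suc:
  "polys_below (Suc d) = (\<lambda>(c, b). pCons c b) ` (UNIV \<times> (polys_below d :: 'k::{field,finite} poly set))"
proof (intro equalityI subsetI)
  fix b :: "'k poly" assume b: "b \<in> polys_below (Suc d)"
  obtain c b' where eq: "b = pCons c b'"
    by (cases b)
  have "poly.coeff b' n = 0" if "d \<le> n" for n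
  proof -
    have "poly.coeff b (Suc n) = 0"
      using b that unfolding polys_below_def by blast
    then show ?thesis
      by (simp add: eq)
  qed
  then have "b' \<in> polys_below d"
    by (simp add: polys_below_def)
  then show "b \<in> (\<lambda>(c, b). pCons c b) ` (UNIV \<times> polys_below d)"
    unfolding eq by force
qed (auto simp: polys_below_def coeff_pCons split: nat.splits)

lemma finite_polys_below [simp]: "finite (polys_below d)"
  by (induction d) (simp_all add: polys_below_0 polys_below_Suc)

text \<open>The constant coefficient is split off, not the leading one, because the recursion from z
  to (z - c w) / T consumes it first.\<close>

lemma sum_polys_below_Suc:
  "(\<Sum>b\<in>polys_below (Suc d). f b) = (\<Sum>c\<in>UNIV. \<Sum>b\<in>polys_below d. f (pCons c b))"
proof -
  have "inj_on (\<lambda>(c, b). pCons c b) (UNIV \<times> polys_below d)"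
    by (auto simp: inj_on_def)
  then show ?thesis
    unfolding polys_below_Suc sum.cartesian_product
    by (subst sum.reindex) (auto intro!: sum.cong)
qed

lemma mono_polys_below: "mono polys_below"
  by (auto simp: mono_def polys_below_def)

lemma degree_less_in_polys_below: "Polynomial.degree b < d \<Longrightarrow> b \<in> polys_below d"
  by (auto simp: polys_below_def intro: coeff_eq_0)

lemma degree_less_of_polys_below: "b \<in> polys_below d \<Longrightarrow> b \<noteq> 0 \<Longrightarrow> Polynomial.degree b < d"
  by (metis (mono_tags, lifting) leading_coeff_0_iff linorder_not_less mem_Collect_eq polys_below_def)

lemma zero_notin_A_plus: "0 \<notin> A_plus"
  by (simp add: A_plus_def)

lemma polys_below_eq_monic_multiples:
  "(polys_below d :: 'k::{field,finite} poly set) - {0} = (\<lambda>(c, b). Polynomial.smult c b) ` ((UNIV - {0}) \<times> (A_plus \<inter> polys_below d))"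
proof (intro equalityI subsetI)
  fix b :: "'k poly" assume b: "b \<in> polys_below d - {0}"
  define c where "c = Polynomial.lead_coeff b"
  have c: "c \<noteq> 0"
    using b by (simp add: c_def)
  have "b = Polynomial.smult c (Polynomial.smult (inverse c) b)"
    using c by simp
  moreover have "Polynomial.smult (inverse c) b \<in> A_plus \<inter> polys_below d"
    using b c by (auto simp: A_plus_def polys_below_def) (simp add: c_def)
  ultimately show "b \<in> (\<lambda>(c, b). Polynomial.smult c b) ` ((UNIV - {0}) \<times> (A_plus \<inter> polys_below d))"
    using c by (intro image_eqI[where x = "(c, Polynomial.smult (inverse c) b)"]) auto
qed (auto simp: polys_below_def A_plus_def)

lemma inj_on_smult_A_plus:
  "inj_on (\<lambda>(c, b). Polynomial.smult c b) ((UNIV - {0 :: 'k::{field,finite}}) \<times> A_plus)"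
proof (rule inj_onI)
  fix p p' :: "'k \<times> 'k poly"
  assume p: "p \<in> (UNIV - {0}) \<times> A_plus" "p' \<in> (UNIV - {0}) \<times> A_plus"
    and eq: "(case p of (c, b) \<Rightarrow> Polynomial.smult c b) = (case p' of (c, b) \<Rightarrow> Polynomial.smult c b)"
  obtain c b c' b' where cb: "p = (c, b)" "p' = (c', b')"
    by (cases p, cases p')
  have "c = c'"
    using arg_cong[OF eq, of Polynomial.lead_coeff] p by (simp add: cb A_plus_def)
  moreover have "b = b'"
    using eq p \<open>c = c'\<close> smult_cancel[of c b b'] by (simp add: cb)
  ultimately show "p = p'"
    by (simp add: cb)
qed

text \<open>Every nonzero polynomial is uniquely a unit times a monic one; for the reciprocals to be
  summed, the inner sum over the units has a closed form.\<close>

lemma sum_polys_below_monic: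
  "(\<Sum>b\<in>polys_below d. f b)
    = f 0 + (\<Sum>b\<in>A_plus \<inter> polys_below d. \<Sum>c\<in>UNIV - {0}. f (Polynomial.smult c b))"
proof -
  have "0 \<in> polys_below d"
    by (simp add: polys_below_def)
  then have "(\<Sum>b\<in>polys_below d. f b) = f 0 + (\<Sum>b\<in>polys_below d - {0}. f b)"
    by (subst sum.remove[of _ 0]) simp_all
  also have "(\<Sum>b\<in>polys_below d - {0}. f b)
      = (\<Sum>(c, b)\<in>(UNIV - {0}) \<times> (A_plus \<inter> polys_below d). f (Polynomial.smult c b))"
    unfolding polys_below_eq_monic_multiples
    by (subst sum.reindex) (auto intro: inj_on_subset[OF inj_on_smult_A_plus] simp: split_beta)
  also have "\<dots> = (\<Sum>b\<in>A_plus \<inter> polys_below d. \<Sum>c\<in>UNIV - {0}. f (Polynomial.smult c b))"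
    unfolding sum.cartesian_product[symmetric] by (rule sum.swap)
  finally show ?thesis .
qed

context C_infinity
begin

lemma em_smult: "em (Polynomial.smult c a) = cst c * em a"
proof -
  have "Polynomial.smult c a = [:c:] * a"
    by simp
  then show ?thesis
    by (simp only: em_mult)
qed

lemma finite_absv_em_le: "finite {a. absv (em a) \<le> M}"
proof -
  have q: "1 < real CARD('k)"
    using two_le_card_field[where 'k = 'k] by simp
  obtain d where d: "M < real CARD('k) ^ d"
    using real_arch_pow[OF q] by blast
  have "a \<in> polys_below d" if a: "absv (em a) \<le> M" for a
  proof (cases "a = 0")
    case False
    then have "real CARD('k) ^ Polynomial.degree a < real CARD('k) ^ d"
      using a d by (simp add: absv_em)
    then show ?thesis
      using q by (intro degree_less_in_polys_below) (simp add: power_strict_increasing_iff)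
  qed (simp add: polys_below_def)
  then have "{a. absv (em a) \<le> M} \<subseteq> polys_below d"
    by blast
  then show ?thesis
    by (rule finite_subset) simp
qed

text \<open>Only finitely many polynomials lie below any given absolute value, so decay like 1 /
  \<bar>b\<bar> outside a ball suffices.\<close>

lemma null_on_A_plusI:
  assumes "\<And>b. b \<in> A_plus \<Longrightarrow> M < absv (em b) \<Longrightarrow> absv (f b) \<le> C / absv (em b)"
  shows "null_on f A_plus"
  unfolding null_on_def
proof (intro allI impI)
  fix r :: real assume r: "r > 0"
  have "absv (em b) \<le> max M (C / r)" if "b \<in> A_plus" "r \<le> absv (f b)" for b
  proof (rule ccontr)
    assume "\<not> ?thesis"
    then have M: "M < absv (em b)" and C: "C / r < absv (em b)"
      by auto
    have "b \<noteq> 0"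
      using that(1) zero_notin_A_plus by blast
    then have pos: "0 < absv (em b)"
      by simp
    have "r \<le> C / absv (em b)"
      using assms[OF that(1) M] that(2) by linarith
    then have "r * absv (em b) \<le> C"
      using pos by (simp add: pos_le_divide_eq)
    moreover have "C < absv (em b) * r"
      using C r by (simp add: pos_divide_less_eq)
    ultimately show False
      by (simp add: mult.commute)
  qed
  then have "{b\<in>A_plus. r \<le> absv (f b)} \<subseteq> {b. absv (em b) \<le> max M (C / r)}"
    by blast
  then show "finite {b\<in>A_plus. r \<le> absv (f b)}"
    by (rule finite_subset) (rule finite_absv_em_le)
qed

end

context carlitz_period
begin

text \<open>l is a T-torsion point: 0 = e(T (w / T)) = (T + l^(q - 1)) l. It is nonzero because w /
  T = w a would make T invertible in A.\<close>

lemma carlitz_exp_torsion: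
  defines "l \<equiv> e (w / T)"
  shows "l ^ (CARD('k) - 1) = - T"
proof -
  have "l \<noteq> 0"
  proof
    assume "l = 0"
    then obtain a where "w / T = w * em a"
      unfolding l_def carlitz_exp_eq_0_iff by blast
    then have "1 = em [:0, 1:] * em a"
      by (simp add: field_simps)
    then have "1 = [:0, 1:] * a"
      by (simp only: em_1[symmetric] em_mult[symmetric] em_eq_iff)
    from arg_cong[OF this, of "\<lambda>p. poly p 0"] show False
      by simp
  qed
  have "e (T * (w / T)) = 0"
    using carlitz_exp_lattice[of 1] by simp
  then have "(T + l ^ (CARD('k) - 1)) * l = 0"
    unfolding carlitz_exp_T l_def[symmetric] card_power_pred[of l] by (simp only: distrib_right)
  with \<open>l \<noteq> 0\<close> show ?thesis
    by (simp add: eq_neg_iff_add_eq_0 add.commute)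
qed

text \<open>With x = e(z / T), the value e(z) = x^q + T x is the product of the q factors x - c l,
  and these are the values e((z - c w) / T). The numerator -l^(q - 1) = T of the partial fractions
  cancels against 1 / T.\<close>

lemma inverse_carlitz_exp_step:
  assumes "e z \<noteq> 0"
  shows "1 / e z = (\<Sum>c\<in>UNIV. 1 / (T * e ((z - cst c * w) / T)))"
proof -
  define x where "x = e (z / T)"
  define l where "l = e (w / T)"
  have l: "l ^ (CARD('k) - 1) = - T"
    unfolding l_def by (rule carlitz_exp_torsion)
  have ez: "e z = x ^ CARD('k) - l ^ (CARD('k) - 1) * x"
  proof -
    have "e z = e (T * (z / T))"
      by simp
    also have "\<dots> = T * x + x ^ CARD('k)"
      unfolding carlitz_exp_T x_def ..
    finally show ?thesis
      unfolding l by simp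
  qed
  have "e ((z - cst c * w) / T) = x - cst c * l" for c
  proof -
    have "(z - cst c * w) / T = z / T - cst c * (w / T)"
      by (simp add: diff_divide_distrib)
    then show ?thesis
      by (simp only: carlitz_exp_diff carlitz_exp_cst x_def l_def)
  qed
  then have "(\<Sum>c\<in>UNIV. 1 / (T * e ((z - cst c * w) / T))) = (\<Sum>c\<in>UNIV. 1 / T * (1 / (x - cst c * l)))"
    by simp
  also have "\<dots> = 1 / T * (\<Sum>c\<in>UNIV. 1 / (x - cst c * l))"
    by (rule sum_distrib_left[symmetric])
  also have "\<dots> = 1 / T * (- (l ^ (CARD('k) - 1)) / e z)"
    by (simp only: sum_inverse_linear_cst[of x l, folded ez, OF assms])
  also have "\<dots> = 1 / e z"
    unfolding l by simp
  finally show ?thesis ..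
qed

lemma carlitz_exp_nonzero_shift:
  assumes "e z \<noteq> 0"
  shows "e ((z - cst c * w) / T) \<noteq> 0"
proof
  assume 0: "e ((z - cst c * w) / T) = 0"
  have "e (T * ((z - cst c * w) / T)) = 0"
    unfolding carlitz_exp_T 0 by simp
  moreover have "e (cst c * w) = 0"
    using carlitz_exp_lattice[of "[:c:]"] by (simp only: mult.commute)
  ultimately show False
    using assms by (simp add: carlitz_exp_diff)
qed

text \<open>Exact for every d; the limit is taken only afterwards, when each summand is compared
  with 1 / (z - w b).\<close>

lemma inverse_carlitz_exp_polys_below:
  "e z \<noteq> 0 \<Longrightarrow> 1 / e z = (\<Sum>b\<in>polys_below d. 1 / (T ^ d * e ((z - w * em b) / T ^ d)))"
proof (induction d arbitrary: z)
  case 0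
  then show ?case
    by (simp add: polys_below_0)
next
  case (Suc d)
  have step: "1 / (T * e ((z - cst c * w) / T))
      = (\<Sum>b\<in>polys_below d. 1 / (T ^ Suc d * e ((z - w * em (pCons c b)) / T ^ Suc d)))" for c
  proof -
    have "((z - cst c * w) / T - w * em b) / T ^ d = (z - w * em (pCons c b)) / T ^ Suc d" for b
    proof -
      have "T * ((z - cst c * w) / T - w * em b) = z - cst c * w - T * (w * em b)"
        by (subst right_diff_distrib)
           (simp only: times_divide_eq_right nonzero_mult_div_cancel_left[OF T_nonzero])
      also have "\<dots> = z - w * em (pCons c b)"
        by (simp only: em_pCons[of c b] distrib_left mult_ac diff_diff_eq)
      finally have "T * ((z - cst c * w) / T - w * em b) = z - w * em (pCons c b)" .
      from this[symmetric] show ?thesis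
        by (simp only: power_Suc mult_divide_mult_cancel_left[OF T_nonzero])
    qed
    then have "1 / e ((z - cst c * w) / T)
        = (\<Sum>b\<in>polys_below d. 1 / (T ^ d * e ((z - w * em (pCons c b)) / T ^ Suc d)))"
      using Suc.IH[OF carlitz_exp_nonzero_shift[OF Suc.prems, of c]] by (simp only:)
    then have "1 / T * (1 / e ((z - cst c * w) / T))
        = (\<Sum>b\<in>polys_below d. 1 / T * (1 / (T ^ d * e ((z - w * em (pCons c b)) / T ^ Suc d))))"
      by (simp only: sum_distrib_left)
    then show ?thesis
      by (simp only: times_divide_times_eq mult_1 mult_1_right power_Suc mult.assoc)
  qed
  show ?case
    unfolding sum_polys_below_Suc inverse_carlitz_exp_step[OF Suc.prems] step ..
qed

lemma absv_carlitz_exp_ball: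
  assumes "absv v < absv w"
  shows "absv (e v) = absv v"
proof (rule absv_carlitz_exp_eq)
  show "absv v ^ (CARD('k) - 1) < real CARD('k) ^ CARD('k)"
    unfolding absv_w[symmetric]
    by (rule power_strict_mono[OF assms]) (use two_le_card_field[where 'k = 'k] in auto)
qed

lemma absv_carlitz_exp_diff_le_ball:
  assumes "absv v < absv w"
  shows "absv (e v - v) \<le> absv v ^ CARD('k) / real CARD('k) ^ CARD('k)"
proof (rule absv_carlitz_exp_diff_le)
  show "absv v ^ (CARD('k) - 1) \<le> real CARD('k) ^ CARD('k)"
    unfolding absv_w[symmetric] by (rule power_mono) (use assms in auto)
qed

text \<open>With v = y / T^(d + 1) the difference is (v - e v) / (T^(d + 1) v e v), where \<bar>e
  v\<bar> = \<bar>v\<bar> and \<bar>e v - v\<bar> \<le> \<bar>v\<bar>^q / q^q. The bound does not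
  involve y, so it is uniform over the lattice translates. The hypothesis uses d, not d + 1, to
  place v strictly inside the ball of radius \<bar>w\<bar>.\<close>

lemma absv_reciprocal_scaled_exp_diff_le:
  assumes y: "y \<noteq> 0" and small: "absv y \<le> absv w * real CARD('k) ^ d"
  shows "absv (1 / (T ^ Suc d * e (y / T ^ Suc d)) - 1 / y)
    \<le> absv w ^ (CARD('k) - 2) / real CARD('k) ^ CARD('k) / real CARD('k) ^ Suc d"
proof -
  let ?q = "CARD('k)"
  have q: "2 \<le> ?q" "0 < real ?q"
    using two_le_card_field[where 'k = 'k] by auto
  define v where "v = y / T ^ Suc d"
  have yv: "y = T ^ Suc d * v" and v: "v \<noteq> 0"
    using y by (simp_all add: v_def)
  have T: "absv (T ^ Suc d) = real ?q ^ Suc d"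
    by (simp only: nrm_power absv_T)
  have "real ?q ^ d * (real ?q * absv v) \<le> real ?q ^ d * absv w"
    using small by (simp only: yv nrm_mult[of "T ^ Suc d"] T) (simp add: mult_ac)
  then have "real ?q * absv v \<le> absv w"
    by (rule mult_left_le_imp_le) (use q in simp)
  moreover have "2 * absv v \<le> real ?q * absv v"
    using q by (intro mult_right_mono) auto
  moreover have "0 < absv v"
    using v by simp
  ultimately have vw: "absv v < absv w"
    by linarith
  have ev: "absv (e v) = absv v"
    by (rule absv_carlitz_exp_ball[OF vw])
  then have ev0: "e v \<noteq> 0"
    using v by (metis nrm_eq_0_iff)
  have "1 / (T ^ Suc d * e v) - 1 / y = (v - e v) / (T ^ Suc d * (e v * v))"
    using v ev0 by (simp add: yv field_simps)
  then have "absv (1 / (T ^ Suc d * e v) - 1 / y) = absv (e v - v) / (real ?q ^ Suc d * (absv v * absv v))"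
    by (simp only: nrm_divide nrm_mult T ev nrm_minus_commute)
  also have "\<dots> \<le> (absv v ^ ?q / real ?q ^ ?q) / (real ?q ^ Suc d * (absv v * absv v))"
    by (rule divide_right_mono[OF absv_carlitz_exp_diff_le_ball[OF vw]]) simp
  also have "absv v ^ ?q = absv v ^ (?q - 2) * (absv v * absv v)"
  proof -
    have "?q = (?q - 2) + 2"
      using q by simp
    then have "absv v ^ ?q = absv v ^ ((?q - 2) + 2)"
      by simp
    then show ?thesis
      by (simp only: power_add power2_eq_square)
  qed
  also have "absv v ^ (?q - 2) * (absv v * absv v) / real ?q ^ ?q / (real ?q ^ Suc d * (absv v * absv v))
      = absv v ^ (?q - 2) / real ?q ^ ?q / real ?q ^ Suc d"
    using v by (simp add: field_simps)
  also have "\<dots> \<le> absv w ^ (?q - 2) / real ?q ^ ?q / real ?q ^ Suc d"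
    using vw by (intro divide_right_mono power_mono) auto
  finally show ?thesis
    by (simp only: v_def)
qed

lemma inverse_carlitz_exp_limit:
  assumes "e z \<noteq> 0"
  shows "(\<lambda>d. \<Sum>b\<in>polys_below d. 1 / (z - w * em b)) \<longlonglongrightarrow> 1 / e z"
proof -
  let ?q = "CARD('k)"
  have q: "1 < real ?q"
    using two_le_card_field[where 'k = 'k] by simp
  define M where "M = absv w ^ (?q - 2) / real ?q ^ ?q"
  \<comment> \<open>From d0 on, every z - w b with b of degree at most d lies in the ball required
    by \<open>absv_reciprocal_scaled_exp_diff_le\<close>.\<close>
  obtain d0 where d0: "absv z / absv w < real ?q ^ d0"
    using real_arch_pow[OF q] by blast
  have bound: "absv ((\<Sum>b\<in>polys_below (Suc d). 1 / (z - w * em b)) - 1 / e z) \<le> M / real ?q ^ Suc d"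
    if d: "d0 \<le> d" for d
  proof -
    have "real ?q ^ d0 \<le> real ?q ^ d"
      using q d by (intro power_increasing) auto
    then have "absv z / absv w \<le> real ?q ^ d"
      using d0 by linarith
    then have z: "absv z \<le> absv w * real ?q ^ d"
      by (simp add: pos_divide_le_eq mult.commute)
    have tm: "absv (1 / (T ^ Suc d * e ((z - w * em b) / T ^ Suc d)) - 1 / (z - w * em b)) \<le> M / real ?q ^ Suc d"
      if b: "b \<in> polys_below (Suc d)" for b
      unfolding M_def
    proof (rule absv_reciprocal_scaled_exp_diff_le)
      show "z - w * em b \<noteq> 0"
        using assms by auto
      have "absv (em b) \<le> real ?q ^ d"
      proof (cases "b = 0")
        case False
        have "Polynomial.degree b \<le> d"
          using degree_less_of_polys_below[OF b False] by simp
        then show ?thesis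
          using q False by (simp add: absv_em power_increasing)
      qed simp
      then have "absv (w * em b) \<le> absv w * real ?q ^ d"
        unfolding nrm_mult by (rule mult_left_mono) simp
      then show "absv (z - w * em b) \<le> absv w * real ?q ^ d"
        by (rule nrm_diff_le[OF z])
    qed
    \<comment> \<open>The number of summands grows with d, but the sum inherits the bound of a
      single one.\<close>
    have "absv (\<Sum>b\<in>polys_below (Suc d).
        1 / (T ^ Suc d * e ((z - w * em b) / T ^ Suc d)) - 1 / (z - w * em b)) \<le> M / real ?q ^ Suc d"
      by (rule nrm_sum_le) (simp add: M_def, rule tm)
    then show ?thesis
      unfolding sum_subtractf inverse_carlitz_exp_polys_below[OF assms, of "Suc d", symmetric]
      by (simp only: nrm_minus_commute)
  qed
  have lim0: "(\<lambda>d. M / real ?q ^ Suc d) \<longlonglongrightarrow> 0"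
  proof -
    have "(\<lambda>d. M * inverse (real ?q) ^ Suc d) \<longlonglongrightarrow> M * 0"
      using q by (intro tendsto_mult_left LIMSEQ_Suc LIMSEQ_realpow_zero) (auto simp: inverse_less_1_iff)
    then show ?thesis
      by (simp add: divide_inverse power_inverse)
  qed
  have "(\<lambda>d. absv ((\<Sum>b\<in>polys_below (Suc d). 1 / (z - w * em b)) - 1 / e z)) \<longlonglongrightarrow> 0"
    by (rule real_tendsto_sandwich[OF _ eventually_mono[OF eventually_ge_at_top[of d0] bound] tendsto_const lim0])
       simp
  then have "(\<lambda>d. \<Sum>b\<in>polys_below (Suc d). 1 / (z - w * em b)) \<longlonglongrightarrow> 1 / e z"
    unfolding tendsto_nrm_iff[where l = "1 / e z"] .
  then show ?thesis
    by (rule LIMSEQ_imp_Suc)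
qed

text \<open>By \<open>prod_minus_cst\<close> the expression is the product of z - c w b over all c,
  and a vanishing factor would make z a lattice point.\<close>

lemma nonzero_minus_multiples:
  assumes "e z \<noteq> 0"
  shows "z ^ CARD('k) - (w * em b) ^ (CARD('k) - 1) * z \<noteq> 0"
proof
  assume "z ^ CARD('k) - (w * em b) ^ (CARD('k) - 1) * z = 0"
  then have "(\<Prod>c\<in>UNIV. z - cst c * (w * em b)) = 0"
    by (simp only: prod_minus_cst)
  then obtain c where "z - cst c * (w * em b) = 0"
    by (auto simp: prod_zero_iff)
  then have "z = w * em (Polynomial.smult c b)"
    by (simp add: em_smult mult_ac)
  with assms show False
    by simp
qed

text \<open>This is \<open>sum_inverse_linear_cst\<close> for l = w b, minus the term 1 / z at c =
  0.\<close>

lemma sum_inverse_monic_multiples: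
  assumes "e z \<noteq> 0"
  shows "(\<Sum>c\<in>UNIV - {0}. 1 / (z - w * em (Polynomial.smult c b)))
    = - (1 / z) * (z ^ (CARD('k) - 1) / (z ^ (CARD('k) - 1) - (w * em b) ^ (CARD('k) - 1)))"
proof -
  let ?l = "w * em b" and ?s = "CARD('k) - 1"
  have z: "z \<noteq> 0"
    using assms by auto
  have nz: "z ^ CARD('k) - ?l ^ ?s * z \<noteq> 0"
    by (rule nonzero_minus_multiples[OF assms])
  have fac: "z ^ CARD('k) - ?l ^ ?s * z = (z ^ ?s - ?l ^ ?s) * z"
    unfolding card_power_pred[of z] by (rule left_diff_distrib[symmetric])
  have nz': "z ^ ?s - ?l ^ ?s \<noteq> 0"
    using nz unfolding fac by auto
  have "(\<Sum>c\<in>UNIV. 1 / (z - cst c * ?l)) = 1 / z + (\<Sum>c\<in>UNIV - {0}. 1 / (z - cst c * ?l))"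
    by (subst sum.remove[of UNIV 0]) simp_all
  then have "(\<Sum>c\<in>UNIV - {0}. 1 / (z - cst c * ?l)) = - (?l ^ ?s) / ((z ^ ?s - ?l ^ ?s) * z) - 1 / z"
    using sum_inverse_linear_cst[OF nz] unfolding fac by simp
  also have "\<dots> = - (1 / z) * (z ^ ?s / (z ^ ?s - ?l ^ ?s))"
    using z nz' by (simp add: field_simps)
  finally show ?thesis
    by (simp only: em_smult mult.left_commute)
qed

lemma null_on_partial_fraction:
  "null_on (\<lambda>b. z ^ (CARD('k) - 1) / (z ^ (CARD('k) - 1) - (w * em b) ^ (CARD('k) - 1))) A_plus"
proof (rule null_on_A_plusI)
  let ?s = "CARD('k) - 1"
  fix b :: "'k poly" assume b: "b \<in> A_plus" and big: "absv z / absv w < absv (em b)"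
  have s: "1 \<le> ?s"
    using two_le_card_field[where 'k = 'k] by simp
  have zw: "absv z < absv (w * em b)"
    using big by (simp add: nrm_mult pos_divide_less_eq mult.commute)
  then have "absv (z ^ ?s) < absv ((w * em b) ^ ?s)"
    unfolding nrm_power using s by (intro power_strict_mono) auto
  then have "absv (z ^ ?s - (w * em b) ^ ?s) = absv ((w * em b) ^ ?s)"
    by (subst nrm_minus_commute) (rule nrm_diff_eq)
  then have "absv (z ^ ?s / (z ^ ?s - (w * em b) ^ ?s)) = (absv z / absv (w * em b)) ^ ?s"
    by (simp only: nrm_divide nrm_power power_divide)
  also have "\<dots> \<le> (absv z / absv (w * em b)) ^ 1"
  proof (rule power_decreasing[OF s])
    show "absv z / absv (w * em b) \<le> 1"
      using zw by (simp add: divide_le_eq_1)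
  qed simp
  also have "\<dots> = absv z / absv w / absv (em b)"
    by (simp add: nrm_mult)
  finally show "absv (z ^ ?s / (z ^ ?s - (w * em b) ^ ?s)) \<le> absv z / absv w / absv (em b)" .
qed

text \<open>Summability is known beforehand, so the value S can be found along the exhaustion by
  degree, where \<open>sum_polys_below_monic\<close> turns the partial fractions of 1 / e(z) into (1
  / z) (1 - S).\<close>

lemma has_sum_partial_fraction:
  assumes "e z \<noteq> 0"
  shows "((\<lambda>b. z ^ (CARD('k) - 1) / (z ^ (CARD('k) - 1) - (w * em b) ^ (CARD('k) - 1)))
    has_sum (1 - z / e z)) A_plus"
proof -
  let ?f = "\<lambda>b. z ^ (CARD('k) - 1) / (z ^ (CARD('k) - 1) - (w * em b) ^ (CARD('k) - 1))"
  have z: "z \<noteq> 0"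
    using assms by auto
  obtain S where S: "(?f has_sum S) A_plus"
    by (rule has_sum_null_onE[OF null_on_partial_fraction])
  have mono: "mono (\<lambda>d. A_plus \<inter> polys_below d)"
    using mono_polys_below by (auto simp: mono_def)
  have "A_plus \<subseteq> (\<Union>d. A_plus \<inter> polys_below d)"
    using degree_less_in_polys_below by blast
  then have "(\<lambda>d. \<Sum>b\<in>A_plus \<inter> polys_below d. ?f b) \<longlonglongrightarrow> S"
    by (intro has_sum_exhaust_limit[OF S] mono) auto
  then have "(\<lambda>d. absv ((\<Sum>b\<in>A_plus \<inter> polys_below d. ?f b) - S)) \<longlonglongrightarrow> 0"
    unfolding tendsto_nrm_iff[where l = S] .
  then have "(\<lambda>d. absv (1 / z) * absv ((\<Sum>b\<in>A_plus \<inter> polys_below d. ?f b) - S)) \<longlonglongrightarrow> absv (1 / z) * 0"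
    by (rule tendsto_mult_left)
  moreover have "absv (1 / z) * absv ((\<Sum>b\<in>A_plus \<inter> polys_below d. ?f b) - S)
      = absv ((\<Sum>b\<in>polys_below d. 1 / (z - w * em b)) - (1 / z) * (1 - S))" for d
  proof -
    have "(\<Sum>b\<in>polys_below d. 1 / (z - w * em b))
        = 1 / z + (\<Sum>b\<in>A_plus \<inter> polys_below d. - (1 / z) * ?f b)"
      unfolding sum_polys_below_monic sum_inverse_monic_multiples[OF assms] by simp
    also have "\<dots> = 1 / z - (1 / z) * (\<Sum>b\<in>A_plus \<inter> polys_below d. ?f b)"
      unfolding sum_distrib_left[symmetric] by simp
    finally have "(\<Sum>b\<in>polys_below d. 1 / (z - w * em b)) - (1 / z) * (1 - S)
        = - ((1 / z) * ((\<Sum>b\<in>A_plus \<inter> polys_below d. ?f b) - S))"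
      by (simp only: right_diff_distrib) simp
    then show ?thesis
      by (simp only: nrm_minus nrm_mult)
  qed
  ultimately have "(\<lambda>d. absv ((\<Sum>b\<in>polys_below d. 1 / (z - w * em b)) - (1 / z) * (1 - S))) \<longlonglongrightarrow> 0"
    by simp
  then have "(\<lambda>d. \<Sum>b\<in>polys_below d. 1 / (z - w * em b)) \<longlonglongrightarrow> (1 / z) * (1 - S)"
    unfolding tendsto_nrm_iff[where l = "(1 / z) * (1 - S)"] .
  then have "1 / e z = (1 / z) * (1 - S)"
    by (rule LIMSEQ_unique[OF inverse_carlitz_exp_limit[OF assms]])
  then have "z / e z = 1 - S"
    using z by (simp add: divide_inverse mult_ac)
  then have "S = 1 - z / e z"
    by simp
  with S show ?thesis
    by simp
qed

end

section \<open>Bernoulli-Carlitz numbers and zeta values\<close>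

lemma minus_divide_diff_eq:
  fixes x y :: "'a::field"
  assumes "y \<noteq> 0"
  shows "- 1 * (x / (x - y)) = x / y / (1 - x / y)"
proof -
  have "1 - x / y = - (x - y) / y"
    using assms by (simp add: field_simps)
  then show ?thesis
    using assms by (simp add: minus_divide_right)
qed

context C_infinity
begin

lemma K_embed_Fract: "b \<noteq> 0 \<Longrightarrow> K_embed \<iota> (Fract a b) = em a / em b"
  by (simp add: K_embed_def K_to_Kinf_Fract Kinf_embed_divide A_embed_def)

lemma K_embed_to_fract: "K_embed \<iota> (to_fract a) = em a"
  by (simp add: to_fract_def K_embed_Fract)

lemma K_embed_0 [simp]: "K_embed \<iota> 0 = 0"
  using K_embed_to_fract[of 0] by simp

lemma K_embed_1 [simp]: "K_embed \<iota> 1 = 1"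
  using K_embed_to_fract[of 1] by simp

lemma K_embed_add: "K_embed \<iota> (x + y) = K_embed \<iota> x + K_embed \<iota> y"
proof -
  obtain a b c d where xy: "x = Fract a b" "b \<noteq> 0" "y = Fract c d" "d \<noteq> 0"
    by (cases x, cases y)
  then show ?thesis
    by (simp add: K_embed_Fract em_add em_mult add_frac_eq)
qed

lemma K_embed_mult: "K_embed \<iota> (x * y) = K_embed \<iota> x * K_embed \<iota> y"
proof -
  obtain a b c d where xy: "x = Fract a b" "b \<noteq> 0" "y = Fract c d" "d \<noteq> 0"
    by (cases x, cases y)
  then show ?thesis
    by (simp add: K_embed_Fract em_mult)
qed

lemma K_embed_inverse_to_fract: "a \<noteq> 0 \<Longrightarrow> K_embed \<iota> (1 / to_fract a) = 1 / em a"
  using K_embed_Fract[of a 1] by (simp add: Fract_conv_to_fract)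

lemma K_embed_sum: "K_embed \<iota> (\<Sum>i\<in>I. f i) = (\<Sum>i\<in>I. K_embed \<iota> (f i))"
  by (induction I rule: infinite_finite_induct) (simp_all add: K_embed_add)

section \<open>Power series over K and their embedding\<close>

definition K_embed_fps :: "'k poly fract fps \<Rightarrow> 'c fps" where
  "K_embed_fps f = Abs_fps (\<lambda>n. K_embed \<iota> (fps_nth f n))"

lemma K_embed_fps_nth [simp]: "fps_nth (K_embed_fps f) n = K_embed \<iota> (fps_nth f n)"
  by (simp add: K_embed_fps_def)

lemma K_embed_fps_mult: "K_embed_fps (f * g) = K_embed_fps f * K_embed_fps g"
  by (rule fps_ext) (simp add: fps_mult_nth K_embed_sum K_embed_mult)

lemma K_embed_fps_X: "K_embed_fps fps_X = fps_X"
  by (rule fps_ext) simp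

lemma card_power_inj: "CARD('k) ^ i = CARD('k) ^ j \<longleftrightarrow> i = j"
  using two_le_card_field[where 'k = 'k] by (intro power_inject_exp) simp

lemma carlitz_exp_fps_nth_0: "fps_nth carlitz_exp_fps 0 = (0 :: 'k poly fract)"
  by (simp add: carlitz_exp_fps_def)

lemma carlitz_exp_fps_nth_1: "fps_nth carlitz_exp_fps 1 = (1 :: 'k poly fract)"
proof -
  have "{i. CARD('k) ^ i = 1} = {0}"
    using card_power_inj[of _ 0] by auto
  then show ?thesis
    by (simp add: carlitz_exp_fps_def)
qed

text \<open>The divisor has order 1 at the origin, so the quotient in the definition of
  \<open>bernoulli_carlitz\<close> is a genuine one.\<close>

lemma X_div_carlitz_exp_fps: "fps_X / carlitz_exp_fps * carlitz_exp_fps = (fps_X :: 'k poly fract fps)"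
proof -
  have "subdegree (carlitz_exp_fps :: 'k poly fract fps) = 1"
    using carlitz_exp_fps_nth_0 carlitz_exp_fps_nth_1 by (intro subdegreeI) auto
  moreover have "carlitz_exp_fps \<noteq> (0 :: 'k poly fract fps)"
    using carlitz_exp_fps_nth_1 by auto
  ultimately have "(carlitz_exp_fps :: 'k poly fract fps) dvd fps_X"
    by (subst fps_dvd_iff) simp_all
  then show ?thesis
    by (rule dvd_div_mult_self)
qed

text \<open>For \<bar>z\<bar> < 1 the term of index i is at most \<bar>z\<bar>^(q^i), as
  \<bar>D_i\<bar> \<ge> 1, so the terms with q^i \<ge> m are all bounded by \<bar>z\<bar>^m.\<close>

lemma has_expansion_carlitz_exp: "has_expansion e (K_embed_fps carlitz_exp_fps)"
  unfolding has_expansion_def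
proof
  fix m
  have "absv (e z - (\<Sum>n<m. fps_nth (K_embed_fps carlitz_exp_fps) n * z ^ n)) \<le> 1 * absv z ^ m"
    if z: "z \<noteq> 0" "absv z < 1" for z
  proof -
    define S where "S = {i. CARD('k) ^ i < m}"
    have "i < CARD('k) ^ i" for i
      using two_le_card_field[where 'k = 'k] by (intro power_gt_expt) simp
    then have "S \<subseteq> {..<m}"
      unfolding S_def by (auto intro: less_trans)
    then have S: "finite S"
      by (rule finite_subset) simp
    have "fps_nth (K_embed_fps carlitz_exp_fps) n * z ^ n = (\<Sum>i | i \<in> S \<and> CARD('k) ^ i = n. carlitz_term z i)"
      if "n < m" for n
    proof -
      have "{i. CARD('k) ^ i = n} = {i. i \<in> S \<and> CARD('k) ^ i = n}"
        using that by (auto simp: S_def)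
      then show ?thesis
        by (simp add: carlitz_exp_fps_def K_embed_sum K_embed_inverse_to_fract sum_distrib_right
            carlitz_term_def)
    qed
    then have "(\<Sum>n<m. fps_nth (K_embed_fps carlitz_exp_fps) n * z ^ n)
        = (\<Sum>n<m. \<Sum>i | i \<in> S \<and> CARD('k) ^ i = n. carlitz_term z i)"
      by (intro sum.cong refl) simp
    also have "\<dots> = sum (carlitz_term z) S"
      by (rule sum.group[OF S]) (auto simp: S_def)
    finally have eq: "(\<Sum>n<m. fps_nth (K_embed_fps carlitz_exp_fps) n * z ^ n) = sum (carlitz_term z) S" .
    have "absv (sum (carlitz_term z) S - e z) \<le> absv z ^ m"
    proof (rule has_sum_approx[OF has_sum_carlitz_term S])
      fix i assume "i \<in> UNIV - S"
      then have i: "m \<le> CARD('k) ^ i"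
        by (simp add: S_def)
      have "absv (carlitz_term z i) = absv z ^ (CARD('k) ^ i) / absv (em (carlitz_D i))"
        by (simp add: carlitz_term_def nrm_divide nrm_power)
      also have "\<dots> \<le> absv z ^ (CARD('k) ^ i) / 1"
        by (rule divide_left_mono) (simp_all add: one_le_absv_em)
      also have "\<dots> \<le> absv z ^ m"
        using z i by (simp add: power_decreasing)
      finally show "absv (carlitz_term z i) \<le> absv z ^ m" .
    qed (use z in auto)
    then show ?thesis
      unfolding eq by (simp only: nrm_minus_commute mult_1)
  qed
  then show "\<exists>C r. r > 0 \<and> (\<forall>z. z \<noteq> 0 \<and> absv z < r \<longrightarrow>
      absv (e z - (\<Sum>n<m. fps_nth (K_embed_fps carlitz_exp_fps) n * z ^ n)) \<le> C * absv z ^ m)"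
    by (intro exI[of _ 1] conjI allI impI) auto
qed

text \<open>Meant for the product of z / e(z) and e(z), which is known to equal z only near the
  origin, where e(z) is nonzero.\<close>

lemma has_expansion_X:
  assumes "r > 0" "\<And>z. z \<noteq> 0 \<Longrightarrow> absv z < r \<Longrightarrow> h z = z"
  shows "has_expansion h fps_X"
  unfolding has_expansion_def
proof
  fix m
  have "absv (h z - (\<Sum>n<m. fps_nth fps_X n * z ^ n)) \<le> 1 * absv z ^ m"
    if z: "z \<noteq> 0" "absv z < min r 1" for z
  proof -
    have h: "h z = z"
      using assms(2) z by simp
    have X: "fps_nth fps_X n * z ^ n = (if n = 1 then z else 0)" for n
      by simp
    show ?thesis
    proof (cases "m \<le> 1")
      case True
      then have "(\<Sum>n<m. fps_nth fps_X n * z ^ n) = 0"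
        unfolding X by simp
      moreover have "absv z ^ 1 \<le> absv z ^ m"
        using True z by (intro power_decreasing) auto
      ultimately show ?thesis
        by (simp only: h) simp
    next
      case False
      then have "(\<Sum>n<m. fps_nth fps_X n * z ^ n) = z"
        unfolding X by simp
      then show ?thesis
        by (simp only: h) simp
    qed
  qed
  then show "\<exists>C r. r > 0 \<and> (\<forall>z. z \<noteq> 0 \<and> absv z < r \<longrightarrow>
      absv (h z - (\<Sum>n<m. fps_nth fps_X n * z ^ n)) \<le> C * absv z ^ m)"
    using assms(1) by (intro exI[of _ 1] exI[of _ "min r 1"] conjI allI impI) auto
qed

lemma small_nonzero:
  assumes "r > 0"
  shows "\<exists>z :: 'c. z \<noteq> 0 \<and> absv z < r"
proof -
  have q: "1 < real CARD('k)"
    using two_le_card_field[where 'k = 'k] by simp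
  obtain n where "1 / r < real CARD('k) ^ n"
    using real_arch_pow[OF q] by blast
  then have "absv (1 / T ^ n) < r"
    using assms by (simp add: nrm_divide nrm_power absv_T field_simps)
  then show ?thesis
    by (intro exI[of _ "1 / T ^ n"]) simp
qed

section \<open>Zeta values and the expansion of z / e(z)\<close>

definition carlitz_zeta :: "nat \<Rightarrow> 'c" where
  "carlitz_zeta n = (\<Sum>\<^sub>\<infinity>a\<in>A_plus. 1 / em a ^ n)"

lemma has_sum_carlitz_zeta:
  assumes "n > 0"
  shows "((\<lambda>a. 1 / em a ^ n) has_sum carlitz_zeta n) A_plus"
proof -
  have "null_on (\<lambda>a. 1 / em a ^ n) A_plus"
  proof (rule null_on_A_plusI)
    fix b :: "'k poly" assume b: "1 < absv (em b)"
    then have "absv (em b) ^ 1 \<le> absv (em b) ^ n"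
      using assms by (intro power_increasing) auto
    then have "1 / absv (em b) ^ n \<le> 1 / absv (em b)"
      using b unfolding power_one_right
      by (intro divide_left_mono mult_pos_pos zero_less_power) linarith+
    then show "absv (1 / em b ^ n) \<le> 1 / absv (em b)"
      by (simp add: nrm_divide nrm_power)
  qed
  then show ?thesis
    unfolding carlitz_zeta_def by (intro has_sum_infsum null_on_summable)
qed

lemma carlitz_factorial_nonzero: "carlitz_factorial m \<noteq> (0 :: 'k poly)"
  by (simp add: carlitz_factorial_def)

end

context carlitz_period
begin

text \<open>The candidate expansion of z / e(z). Only exponents divisible by q - 1 occur, since it
  proceeds in powers of (z / (w b))^(q - 1); the constant term is not a zeta value.\<close>

definition zeta_fps :: "'c fps" where
  "zeta_fps = Abs_fps (\<lambda>n. if n = 0 then 1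
     else if (CARD('k) - 1) dvd n then carlitz_zeta n / w ^ n else 0)"

lemma carlitz_exp_nonzero_ball: "z \<noteq> 0 \<Longrightarrow> absv z < absv w \<Longrightarrow> e z \<noteq> 0"
  using absv_carlitz_exp_ball[of z] by (metis nrm_eq_0_iff)

text \<open>With u(b) = (z / (w b))^(q - 1), the sum of u / (1 - u) over the monic b is z / e(z) -
  1. Cutting the geometric series before its K-th power leaves u^K / (1 - u), and for \<bar>z\<bar>
  < \<bar>w\<bar> this is at most (\<bar>z\<bar> / \<bar>w\<bar>)^m, uniformly in b.\<close>

lemma has_expansion_quotient: "has_expansion (\<lambda>z. z / e z) zeta_fps"
  unfolding has_expansion_def
proof
  fix m
  let ?s = "CARD('k) - 1"
  have s: "?s > 0"
    using two_le_card_field[where 'k = 'k] by simp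
  \<comment> \<open>The ceiling of m / (q - 1), which is the number of multiples of q - 1 below
    m.\<close>
  define K where "K = (m + ?s - 1) div ?s"
  have K: "k < K \<longleftrightarrow> ?s * k < m" for k
  proof -
    have "k < K \<longleftrightarrow> Suc k \<le> (m + ?s - 1) div ?s"
      by (simp add: K_def Suc_le_eq)
    also have "\<dots> \<longleftrightarrow> Suc k * ?s \<le> m + ?s - 1"
      by (rule less_eq_div_iff_mult_less_eq[OF s])
    also have "\<dots> \<longleftrightarrow> ?s * k < m"
      using s by (simp add: mult.commute) linarith
    finally show ?thesis .
  qed
  have "absv (z / e z - (\<Sum>n<m. fps_nth zeta_fps n * z ^ n)) \<le> (1 / absv w ^ m) * absv z ^ m"
    if z: "z \<noteq> 0" "absv z < absv w" for z
  \<comment> \<open>The case m = 0 is separate because the geometric sums below start at k = 1, so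
    the index 0 has to lie below K.\<close>
  proof (cases "m = 0")
    case True
    have "absv (e z) = absv z"
      by (rule absv_carlitz_exp_ball[OF z(2)])
    then show ?thesis
      using z by (simp add: True nrm_divide)
  next
    case False
    define u where "u b = (z / (w * em b)) ^ ?s" for b
    have absv_u: "absv (u b) \<le> (absv z / absv w) ^ ?s" "absv (u b) < 1" if "b \<in> A_plus" for b
    proof -
      have "1 \<le> absv (em b)"
        using that zero_notin_A_plus by (intro one_le_absv_em) auto
      then have "absv w * 1 \<le> absv w * absv (em b)"
        by (intro mult_left_mono) auto
      then have "absv z / (absv w * absv (em b)) \<le> absv z / absv w"
        using z by (intro divide_left_mono mult_pos_pos) auto
      then show le: "absv (u b) \<le> (absv z / absv w) ^ ?s"
        unfolding u_def nrm_power nrm_divide nrm_mult by (intro power_mono) auto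
      have "(absv z / absv w) ^ ?s < 1 ^ ?s"
        using z s by (intro power_strict_mono) (auto simp: divide_less_eq_1)
      with le show "absv (u b) < 1"
        by simp
    qed
    have ez: "e z \<noteq> 0"
      by (rule carlitz_exp_nonzero_ball[OF z])
    have u_sum: "((\<lambda>b. u b / (1 - u b)) has_sum (z / e z - 1)) A_plus"
    proof -
      have sum: "((\<lambda>b. - 1 * (z ^ ?s / (z ^ ?s - (w * em b) ^ ?s))) has_sum (- 1 * (1 - z / e z))) A_plus"
        by (rule has_sum_cmult_nrm[OF has_sum_partial_fraction[OF ez]])
      have "- 1 * (z ^ ?s / (z ^ ?s - (w * em b) ^ ?s)) = u b / (1 - u b)" if "b \<in> A_plus" for b
      proof -
        have y: "(w * em b) ^ ?s \<noteq> 0"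
          using that zero_notin_A_plus by auto
        then have uz: "u b = z ^ ?s / (w * em b) ^ ?s"
          by (simp only: u_def power_divide)
        show ?thesis
          unfolding uz using y by (rule minus_divide_diff_eq)
      qed
      then have "((\<lambda>b. u b / (1 - u b)) has_sum (- 1 * (1 - z / e z))) A_plus"
        by (rule has_sum_cong[THEN iffD1, OF _ sum])
      then show ?thesis
        by simp
    qed
    have pow_sum: "((\<lambda>b. u b ^ k) has_sum (fps_nth zeta_fps (?s * k) * z ^ (?s * k))) A_plus" if k: "k > 0" for k
    proof -
      have "((\<lambda>b. (z / w) ^ (?s * k) * (1 / em b ^ (?s * k))) has_sum
          ((z / w) ^ (?s * k) * carlitz_zeta (?s * k))) A_plus"
        using s k by (intro has_sum_cmult_nrm has_sum_carlitz_zeta) simp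
      moreover have "(z / w) ^ (?s * k) * (1 / em b ^ (?s * k)) = u b ^ k" for b
        by (simp only: u_def power_mult[symmetric] power_divide power_mult_distrib times_divide_times_eq mult_1_right)
      moreover have "(z / w) ^ (?s * k) * carlitz_zeta (?s * k) = fps_nth zeta_fps (?s * k) * z ^ (?s * k)"
        using s k by (simp add: zeta_fps_def power_divide)
      ultimately show ?thesis
        by simp
    qed
    have Kpos: "K > 0"
      using K[of 0] False by simp
    have zeta: "(\<Sum>n<m. fps_nth zeta_fps n * z ^ n)
        = 1 + (\<Sum>k\<in>{1..<K}. fps_nth zeta_fps (?s * k) * z ^ (?s * k))"
    proof -
      have "(\<Sum>n<m. fps_nth zeta_fps n * z ^ n) = (\<Sum>n\<in>(\<lambda>k. ?s * k) ` {..<K}. fps_nth zeta_fps n * z ^ n)"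
      proof (rule sum.mono_neutral_right)
        show "(\<lambda>k. ?s * k) ` {..<K} \<subseteq> {..<m}"
          using K by auto
        show "\<forall>n\<in>{..<m} - (\<lambda>k. ?s * k) ` {..<K}. fps_nth zeta_fps n * z ^ n = 0"
        proof
          fix n assume n: "n \<in> {..<m} - (\<lambda>k. ?s * k) ` {..<K}"
          have "\<not> ?s dvd n"
          proof
            assume "?s dvd n"
            then obtain k where "n = ?s * k" ..
            with n K show False
              by blast
          qed
          then show "fps_nth zeta_fps n * z ^ n = 0"
            by (cases "n = 0") (simp_all add: zeta_fps_def)
        qed
      qed simp
      also have "\<dots> = (\<Sum>k<K. fps_nth zeta_fps (?s * k) * z ^ (?s * k))"
        using s by (subst sum.reindex) (auto simp: inj_on_def)
      also have "\<dots> = (\<Sum>k\<in>insert 0 {1..<K}. fps_nth zeta_fps (?s * k) * z ^ (?s * k))"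
        using Kpos by (intro sum.cong) auto
      also have "\<dots> = 1 + (\<Sum>k\<in>{1..<K}. fps_nth zeta_fps (?s * k) * z ^ (?s * k))"
        by (subst sum.insert) (simp_all add: zeta_fps_def)
      finally show ?thesis .
    qed
    have sum: "((\<lambda>b. u b / (1 - u b) - (\<Sum>k\<in>{1..<K}. u b ^ k)) has_sum
        (z / e z - 1 - (\<Sum>k\<in>{1..<K}. fps_nth zeta_fps (?s * k) * z ^ (?s * k)))) A_plus"
      by (intro has_sum_diff_nrm u_sum has_sum_sum_nrm pow_sum) auto
    have "u b / (1 - u b) - (\<Sum>k\<in>{1..<K}. u b ^ k) = u b ^ K / (1 - u b)" if "b \<in> A_plus" for b
    proof -
      have ne: "1 - u b \<noteq> 0"
        using absv_u(2)[OF that] nrm_1 by fastforce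
      have "(1 - u b) * (\<Sum>k<K. u b ^ k) = 1 - u b ^ K"
        by (rule one_diff_power_eq[symmetric])
      moreover have "(\<Sum>k<K. u b ^ k) = 1 + (\<Sum>k\<in>{1..<K}. u b ^ k)"
      proof -
        have "(\<Sum>k<K. u b ^ k) = (\<Sum>k\<in>insert 0 {1..<K}. u b ^ k)"
          using Kpos by (intro sum.cong) auto
        then show ?thesis
          by (subst (asm) sum.insert) simp_all
      qed
      ultimately have "(1 - u b) * (1 + (\<Sum>k\<in>{1..<K}. u b ^ k)) = 1 - u b ^ K"
        by simp
      then show ?thesis
        using ne by (simp add: field_simps)
    qed
    then have "((\<lambda>b. u b ^ K / (1 - u b)) has_sum
        (z / e z - 1 - (\<Sum>k\<in>{1..<K}. fps_nth zeta_fps (?s * k) * z ^ (?s * k)))) A_plus"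
      by (rule has_sum_cong[THEN iffD1, OF _ sum])
    then have rest: "((\<lambda>b. u b ^ K / (1 - u b)) has_sum
        (z / e z - (\<Sum>n<m. fps_nth zeta_fps n * z ^ n))) A_plus"
      unfolding zeta by (simp only: diff_diff_eq)
    show ?thesis
    proof (rule has_sum_nrm_le[OF rest])
      fix b :: "'k poly" assume b: "b \<in> A_plus"
      have "absv (1 - u b) = 1"
        using absv_u(2)[OF b] nrm_diff_eq[of "u b" 1] by simp
      then have "absv (u b ^ K / (1 - u b)) = absv (u b) ^ K"
        by (simp add: nrm_divide nrm_power)
      also have "\<dots> \<le> ((absv z / absv w) ^ ?s) ^ K"
        by (rule power_mono[OF absv_u(1)[OF b]]) simp
      also have "\<dots> = (absv z / absv w) ^ (?s * K)"
        by (rule power_mult[symmetric])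
      also have "\<dots> \<le> (absv z / absv w) ^ m"
        using z K[of K] by (intro power_decreasing) auto
      finally show "absv (u b ^ K / (1 - u b)) \<le> (1 / absv w ^ m) * absv z ^ m"
        by (simp add: power_divide)
    qed simp
  qed
  moreover have "0 < absv w"
    by simp
  ultimately show "\<exists>C r. r > 0 \<and> (\<forall>z. z \<noteq> 0 \<and> absv z < r \<longrightarrow>
      absv (z / e z - (\<Sum>n<m. fps_nth zeta_fps n * z ^ n)) \<le> C * absv z ^ m)"
    by (intro exI[of _ "1 / absv w ^ m"] exI[of _ "absv w"] conjI allI impI) auto
qed

text \<open>Both series have product X with the expansion of e: one by uniqueness of asymptotic
  expansions, the other by exactness of the quotient. The common factor is nonzero and
  cancels.\<close>

lemma K_embed_fps_quotient: "K_embed_fps (fps_X / carlitz_exp_fps) = zeta_fps"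
proof -
  let ?F = "K_embed_fps carlitz_exp_fps"
  have "has_expansion (\<lambda>z. z / e z * e z) (zeta_fps * ?F)"
    by (intro has_expansion_mult has_expansion_quotient has_expansion_carlitz_exp)
  moreover have "has_expansion (\<lambda>z. z / e z * e z) fps_X"
    by (rule has_expansion_X[of "absv w"]) (simp_all add: carlitz_exp_nonzero_ball)
  ultimately have "zeta_fps * ?F = fps_X"
    by (rule has_expansion_unique) (rule small_nonzero)
  also have "fps_X = K_embed_fps (fps_X / carlitz_exp_fps) * ?F"
    by (simp only: X_div_carlitz_exp_fps K_embed_fps_X flip: K_embed_fps_mult)
  finally have eq: "zeta_fps * ?F = K_embed_fps (fps_X / carlitz_exp_fps) * ?F" .
  have "fps_nth ?F 1 \<noteq> 0"
    by (simp only: K_embed_fps_nth carlitz_exp_fps_nth_1 K_embed_1) simp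
  then have "?F \<noteq> 0"
    by (metis fps_zero_nth)
  with eq show ?thesis
    by simp
qed

lemma bernoulli_carlitz_eq_zeta:
  "K_embed \<iota> (bernoulli_carlitz n) / em (carlitz_factorial n) = fps_nth zeta_fps n"
  using carlitz_factorial_nonzero[of n]
  by (simp add: bernoulli_carlitz_def K_embed_mult K_embed_to_fract flip: K_embed_fps_quotient)

end

section \<open>The double sum\<close>

text \<open>The left side is (p^(-N) - r^(-N)) / (p - r). The difference of powers of 1 / p and 1 /
  r contains the factor 1 / p - 1 / r = -(p - r) / (p r), which removes the denominator.\<close>

lemma sum_two_partial_fractions:
  fixes p r :: "'a::field"
  assumes "p \<noteq> 0" "r \<noteq> 0" "p \<noteq> r"
  shows "1 / p ^ Suc N * (p / (p - r)) + 1 / r ^ Suc N * (r / (r - p))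
    = - (\<Sum>k\<in>{1..<Suc N}. 1 / p ^ k * (1 / r ^ (Suc N - k)))"
proof -
  define S where "S = (\<Sum>i<N. (1 / r) ^ (N - Suc i) * (1 / p) ^ i)"
  have "(\<Sum>k\<in>{1..<Suc N}. 1 / p ^ k * (1 / r ^ (Suc N - k))) = (\<Sum>i<N. 1 / p ^ Suc i * (1 / r ^ (N - i)))"
    unfolding One_nat_def sum.shift_bounds_Suc_ivl by (simp only: atLeast0LessThan diff_Suc_Suc)
  also have "\<dots> = (\<Sum>i<N. 1 / (p * r) * ((1 / r) ^ (N - Suc i) * (1 / p) ^ i))"
  proof (rule sum.cong[OF refl])
    fix i assume "i \<in> {..<N}"
    then obtain d where "N = Suc (i + d)"
      using less_imp_Suc_add[of i N] by auto
    then have d: "N - i = Suc d" "N - Suc i = d"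
      by simp_all
    show "1 / p ^ Suc i * (1 / r ^ (N - i)) = 1 / (p * r) * ((1 / r) ^ (N - Suc i) * (1 / p) ^ i)"
      unfolding d by (simp only: power_one_over power_Suc times_divide_times_eq mult_1 mult_ac)
  qed
  also have "\<dots> = 1 / (p * r) * S"
    unfolding S_def by (rule sum_distrib_left[symmetric])
  finally have rhs: "(\<Sum>k\<in>{1..<Suc N}. 1 / p ^ k * (1 / r ^ (Suc N - k))) = 1 / (p * r) * S" .
  have "1 / p ^ Suc N * (p / (p - r)) = (1 / p) ^ N / (p - r)"
    using assms(1) by (simp add: power_divide)
  moreover have "1 / r ^ Suc N * (r / (r - p)) = - ((1 / r) ^ N / (p - r))"
  proof -
    have neg: "r / (r - p) = - (r / (p - r))"
      by (simp only: minus_divide_right minus_diff_eq)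
    show ?thesis
      unfolding neg using assms(2) by (simp add: power_divide)
  qed
  ultimately have "1 / p ^ Suc N * (p / (p - r)) + 1 / r ^ Suc N * (r / (r - p))
      = ((1 / p) ^ N - (1 / r) ^ N) / (p - r)"
    by (simp add: diff_divide_distrib)
  also have "\<dots> = (1 / p - 1 / r) * S / (p - r)"
    unfolding S_def by (simp only: power_diff_sumr2)
  also have "1 / p - 1 / r = - ((p - r) * (1 / (p * r)))"
    using assms by (simp add: field_simps)
  also have "- ((p - r) * (1 / (p * r))) * S / (p - r) = - (1 / (p * r) * S)"
    using assms(3) by simp
  finally show ?thesis
    unfolding rhs .
qed

context carlitz_period
begin

text \<open>If z - w b lies in the ball where e preserves absolute values, periodicity gives \<bar>z
  - w b\<bar> = \<bar>e(z)\<bar>; otherwise the distance is at least \<bar>w\<bar>.\<close>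

lemma inverse_absv_lattice_distance_le:
  assumes "e z \<noteq> 0"
  shows "1 / absv (z - w * em b) \<le> max (1 / absv w) (1 / absv (e z))"
proof (cases "absv (z - w * em b) < absv w")
  case True
  then have "absv (e (z - w * em b)) = absv (z - w * em b)"
    by (rule absv_carlitz_exp_ball)
  then have "absv (e z) = absv (z - w * em b)"
    by (simp add: carlitz_exp_diff)
  then show ?thesis
    by simp
next
  case False
  then have "1 / absv (z - w * em b) \<le> 1 / absv w"
    by (intro divide_left_mono) (auto intro!: mult_pos_pos intro: less_le_trans[of 0 "absv w"])
  then show ?thesis
    by simp
qed

text \<open>The fraction is -z times a sum of reciprocals 1 / (z - w c b), one for each unit c, and
  these are bounded uniformly in b.\<close>

lemma absv_partial_fraction_le:
  assumes "e z \<noteq> 0"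
  shows "absv (z ^ (CARD('k) - 1) / (z ^ (CARD('k) - 1) - (w * em b) ^ (CARD('k) - 1)))
    \<le> absv z * max (1 / absv w) (1 / absv (e z))"
proof -
  let ?f = "z ^ (CARD('k) - 1) / (z ^ (CARD('k) - 1) - (w * em b) ^ (CARD('k) - 1))"
  let ?M = "max (1 / absv w) (1 / absv (e z))"
  have z: "z \<noteq> 0"
    using assms by auto
  have "?f = - z * (\<Sum>c\<in>UNIV - {0}. 1 / (z - w * em (Polynomial.smult c b)))"
    unfolding sum_inverse_monic_multiples[OF assms] using z by simp
  then have "absv ?f = absv z * absv (\<Sum>c\<in>UNIV - {0}. 1 / (z - w * em (Polynomial.smult c b)))"
    by (simp only: nrm_mult nrm_minus)
  also have "\<dots> \<le> absv z * ?M"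
  proof (rule mult_left_mono[OF nrm_sum_le])
    fix c
    show "absv (1 / (z - w * em (Polynomial.smult c b))) \<le> ?M"
      using inverse_absv_lattice_distance_le[OF assms] by (simp only: nrm_divide nrm_1)
  qed (simp_all add: le_max_iff_disj)
  finally show ?thesis .
qed

text \<open>
  If \<open>\<alpha> / \<omega>\<close> lies in the completion at infinity, the denominators can be arbitrarily small. A lattice point
  close to \<open>z\<close> makes \<open>e(z)\<close> equally small, so the convergence of the series controls them.
\<close>

lemma null_on_double_sum:
  assumes nz: "\<And>a. a \<in> A_plus \<Longrightarrow> e (\<alpha> * em a) \<noteq> 0"
    and null: "null_on (\<lambda>a. 1 / em a ^ n / e (\<alpha> * em a)) A_plus"
    and n: "n > 0"
  shows "null_on (\<lambda>(a, b). 1 / em a ^ Suc n * ((\<alpha> * em a) ^ (CARD('k) - 1)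
      / ((\<alpha> * em a) ^ (CARD('k) - 1) - (w * em b) ^ (CARD('k) - 1)))) (A_plus \<times> A_plus)"
    (is "null_on (\<lambda>(a, b). 1 / em a ^ Suc n * ?f a b) _")
  unfolding null_on_def
proof (intro allI impI)
  fix r :: real assume r: "r > 0"
  let ?g = "\<lambda>a. \<alpha> / w * (1 / em a ^ n)" and ?h = "\<lambda>a. \<alpha> * (1 / em a ^ n / e (\<alpha> * em a))"
  \<comment> \<open>For a outside this finite set the term is below r for all b at once, since
    \<open>?g\<close> and \<open>?h\<close> carry the two alternatives of the maximum in
    \<open>absv_partial_fraction_le\<close>.\<close>
  define F where "F = {a\<in>A_plus. r \<le> absv (?g a)} \<union> {a\<in>A_plus. r \<le> absv (?h a)}"
  have "null_on ?g A_plus"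
    by (rule has_sum_null_on[OF has_sum_cmult_nrm[OF has_sum_carlitz_zeta[OF n]]])
  moreover have "null_on ?h A_plus"
    by (rule null_on_mono[OF null, where M = "absv \<alpha>"]) (simp only: nrm_mult order_refl)
  ultimately have F: "finite F"
    unfolding F_def using null_onD[OF _ r] by blast
  have "absv (1 / em a ^ Suc n * ?f a b) < r" if a: "a \<in> A_plus" "a \<notin> F" for a b
  proof -
    have pos: "0 < absv (em a)"
      using a(1) zero_notin_A_plus by auto
    have "absv (1 / em a ^ Suc n * ?f a b)
        \<le> absv (1 / em a ^ Suc n) * (absv (\<alpha> * em a) * max (1 / absv w) (1 / absv (e (\<alpha> * em a))))"
      unfolding nrm_mult[of "1 / em a ^ Suc n"]
      by (rule mult_left_mono[OF absv_partial_fraction_le[OF nz[OF a(1)]]]) simp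
    also have "\<dots> = absv \<alpha> / absv (em a) ^ n * max (1 / absv w) (1 / absv (e (\<alpha> * em a)))"
      using pos by (simp add: nrm_divide nrm_mult nrm_power)
    also have "\<dots> = max (absv (?g a)) (absv (?h a))"
      using pos by (subst max_mult_distrib_left) (simp_all add: nrm_divide nrm_mult nrm_power mult.commute)
    also have "\<dots> < r"
      using a by (auto simp: F_def)
    finally show ?thesis .
  qed
  then have "{p \<in> A_plus \<times> A_plus. r \<le> absv (case p of (a, b) \<Rightarrow> 1 / em a ^ Suc n * ?f a b)}
      \<subseteq> Sigma F (\<lambda>a. {b\<in>A_plus. r \<le> absv (1 / em a ^ Suc n * ?f a b)})"
    by (force simp: not_less[symmetric])
  \<comment> \<open>Over each of the finitely many remaining a, the terms tend to zero in b.\<close>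
  moreover have "finite (Sigma F (\<lambda>a. {b\<in>A_plus. r \<le> absv (1 / em a ^ Suc n * ?f a b)}))"
  proof (intro finite_SigmaI F)
    fix a
    have "null_on (\<lambda>b. 1 / em a ^ Suc n * ?f a b) A_plus"
      by (rule null_on_mono[OF null_on_partial_fraction[of "\<alpha> * em a"], where M = "absv (1 / em a ^ Suc n)"])
         (simp only: nrm_mult)
    then show "finite {b\<in>A_plus. r \<le> absv (1 / em a ^ Suc n * ?f a b)}"
      using r by (rule null_onD)
  qed
  ultimately show "finite {p \<in> A_plus \<times> A_plus. r \<le> absv (case p of (a, b) \<Rightarrow> 1 / em a ^ Suc n * ?f a b)}"
    by (rule finite_subset)
qed

definition monic_sum :: "nat \<Rightarrow> 'c \<Rightarrow> 'c" where
  "monic_sum n \<alpha> = (\<Sum>\<^sub>\<infinity>a\<in>A_plus. 1 / em a ^ n / e (\<alpha> * em a))"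

text \<open>Summing over b first gives (1 / a^(n + 1)) (1 - \<alpha> a / e(\<alpha> a)); the factor
  a in the numerator lowers the exponent to n.\<close>

lemma has_sum_double_sum:
  assumes nz: "\<And>a. a \<in> A_plus \<Longrightarrow> e (\<alpha> * em a) \<noteq> 0"
    and summable: "(\<lambda>a. 1 / em a ^ n / e (\<alpha> * em a)) summable_on A_plus"
    and n: "n > 0"
  shows "((\<lambda>(a, b). 1 / em a ^ Suc n * ((\<alpha> * em a) ^ (CARD('k) - 1)
      / ((\<alpha> * em a) ^ (CARD('k) - 1) - (w * em b) ^ (CARD('k) - 1))))
    has_sum (carlitz_zeta (Suc n) - \<alpha> * monic_sum n \<alpha>)) (A_plus \<times> A_plus)"
proof -
  have L: "((\<lambda>a. 1 / em a ^ n / e (\<alpha> * em a)) has_sum monic_sum n \<alpha>) A_plus"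
    unfolding monic_sum_def by (rule has_sum_infsum[OF summable])
  obtain S where S: "((\<lambda>(a, b). 1 / em a ^ Suc n * ((\<alpha> * em a) ^ (CARD('k) - 1)
      / ((\<alpha> * em a) ^ (CARD('k) - 1) - (w * em b) ^ (CARD('k) - 1)))) has_sum S) (A_plus \<times> A_plus)"
    by (rule has_sum_null_onE[OF null_on_double_sum[OF nz has_sum_null_on[OF L] n]])
  have "((\<lambda>a. 1 / em a ^ Suc n * (1 - (\<alpha> * em a) / e (\<alpha> * em a))) has_sum S) A_plus"
    by (rule has_sum_rows[OF S])
       (simp only: prod.case, rule has_sum_cmult_nrm[OF has_sum_partial_fraction[OF nz]])
  moreover have "((\<lambda>a. 1 / em a ^ Suc n * (1 - (\<alpha> * em a) / e (\<alpha> * em a)))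
      has_sum (carlitz_zeta (Suc n) - \<alpha> * monic_sum n \<alpha>)) A_plus"
  proof (rule has_sum_cong[THEN iffD1])
    show "((\<lambda>a. 1 / em a ^ Suc n - \<alpha> * (1 / em a ^ n / e (\<alpha> * em a)))
        has_sum (carlitz_zeta (Suc n) - \<alpha> * monic_sum n \<alpha>)) A_plus"
      by (intro has_sum_diff_nrm has_sum_cmult_nrm L has_sum_carlitz_zeta) simp
    fix a :: "'k poly" assume "a \<in> A_plus"
    then have "em a \<noteq> 0"
      using zero_notin_A_plus by auto
    then show "1 / em a ^ Suc n - \<alpha> * (1 / em a ^ n / e (\<alpha> * em a))
        = 1 / em a ^ Suc n * (1 - (\<alpha> * em a) / e (\<alpha> * em a))"
      by (simp add: right_diff_distrib)
  qed
  ultimately have "S = carlitz_zeta (Suc n) - \<alpha> * monic_sum n \<alpha>"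
    by (rule has_sum_unique_nrm)
  with S show ?thesis
    by simp
qed

lemma reciprocity:
  fixes N :: nat
  defines "n \<equiv> (CARD('k) - 1) * Suc N - 1"
  assumes s: "CARD('k) - 1 = 2 * h"
    and \<alpha>\<beta>: "\<alpha> * \<beta> = w\<^sup>2"
    and nz: "\<forall>a\<in>A_plus. e (\<alpha> * em a) \<noteq> 0" "\<forall>a\<in>A_plus. e (\<beta> * em a) \<noteq> 0"
    and summable: "(\<lambda>a. 1 / em a ^ n / e (\<alpha> * em a)) summable_on A_plus"
      "(\<lambda>a. 1 / em a ^ n / e (\<beta> * em a)) summable_on A_plus"
  shows "1 / (\<alpha> ^ h) ^ Suc N * (\<alpha> * monic_sum n \<alpha>) + 1 / (\<beta> ^ h) ^ Suc N * (\<beta> * monic_sum n \<beta>)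
    = (\<Sum>k=0..Suc N. fps_nth zeta_fps ((CARD('k) - 1) * k) * fps_nth zeta_fps ((CARD('k) - 1) * (Suc N - k))
        * (\<alpha> ^ h) ^ k * (\<beta> ^ h) ^ (Suc N - k))"
proof -
  let ?s = "CARD('k) - 1" and ?J = "Suc N"
  have h: "h > 0"
    using s two_le_card_field[where 'k = 'k] by (cases h) auto
  have n: "n > 0" "Suc n = ?s * ?J"
    using h unfolding n_def s by (cases h; simp)+
  have ab: "\<alpha> \<noteq> 0" "\<beta> \<noteq> 0"
    using \<alpha>\<beta> by auto
  define A where "A = \<alpha> ^ h"
  define B where "B = \<beta> ^ h"
  have AB: "A \<noteq> 0" "B \<noteq> 0"
    using ab by (simp_all add: A_def B_def)
  \<comment> \<open>Since q - 1 = 2 h, the relation \<alpha> \<beta> = w^2 makes w^(q - 1) symmetric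
    in \<alpha>^h and \<beta>^h.\<close>
  have W: "w ^ ?s = A * B"
    unfolding A_def B_def s by (simp only: power_mult power_mult_distrib[symmetric] \<alpha>\<beta>)
  have A2: "\<alpha> ^ ?s = A * A" and B2: "\<beta> ^ ?s = B * B"
    unfolding A_def B_def s by (simp_all add: mult_2 power_add)
  let ?f = "\<lambda>\<alpha> (a, b). 1 / em a ^ Suc n * ((\<alpha> * em a) ^ ?s / ((\<alpha> * em a) ^ ?s - (w * em b) ^ ?s))"
  have f1: "(?f \<alpha> has_sum (carlitz_zeta (Suc n) - \<alpha> * monic_sum n \<alpha>)) (A_plus \<times> A_plus)"
    by (rule has_sum_double_sum[OF bspec[OF nz(1)] summable(1) n(1)])
  have "(?f \<beta> has_sum (carlitz_zeta (Suc n) - \<beta> * monic_sum n \<beta>)) (A_plus \<times> A_plus)"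
    by (rule has_sum_double_sum[OF bspec[OF nz(2)] summable(2) n(1)])
  \<comment> \<open>After swapping the pair, both terms at (a, b) involve only \<alpha>^h a^(q - 1)
    and \<beta>^h b^(q - 1), up to the prefactors.\<close>
  then have f2: "((\<lambda>p. ?f \<beta> (prod.swap p)) has_sum (carlitz_zeta (Suc n) - \<beta> * monic_sum n \<beta>)) (A_plus \<times> A_plus)"
    using has_sum_reindex[of prod.swap "A_plus \<times> A_plus" "?f \<beta>"] by (simp only: product_swap inj_swap comp_def)
  \<comment> \<open>With Z 0 = 1 the coefficients of \<open>zeta_fps\<close> have one formula for
    all k, including the boundary terms of the sum.\<close>
  define Z where "Z k = (if k = 0 then 1 else carlitz_zeta (?s * k))" for k
  have zeta: "fps_nth zeta_fps (?s * k) = Z k / (A * B) ^ k" for k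
    unfolding zeta_fps_def Z_def W[symmetric] using h s by (simp add: power_mult)
  have "((\<lambda>p. 1 / A ^ ?J * ?f \<alpha> p + 1 / B ^ ?J * ?f \<beta> (prod.swap p)) has_sum
      (1 / A ^ ?J * (carlitz_zeta (Suc n) - \<alpha> * monic_sum n \<alpha>)
        + 1 / B ^ ?J * (carlitz_zeta (Suc n) - \<beta> * monic_sum n \<beta>))) (A_plus \<times> A_plus)"
    by (intro has_sum_add_nrm has_sum_cmult_nrm f1 f2)
  moreover have "((\<lambda>p. 1 / A ^ ?J * ?f \<alpha> p + 1 / B ^ ?J * ?f \<beta> (prod.swap p)) has_sum
      (- 1 * (\<Sum>k\<in>{1..<?J}. 1 / (A ^ k * B ^ (?J - k)) * (Z k * Z (?J - k))))) (A_plus \<times> A_plus)"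
  proof (rule has_sum_cong[THEN iffD1])
    show "((\<lambda>p. - 1 * (\<Sum>k\<in>{1..<?J}. 1 / (A ^ k * B ^ (?J - k))
          * (case p of (a, b) \<Rightarrow> 1 / em a ^ (?s * k) * (1 / em b ^ (?s * (?J - k))))))
        has_sum (- 1 * (\<Sum>k\<in>{1..<?J}. 1 / (A ^ k * B ^ (?J - k)) * (Z k * Z (?J - k))))) (A_plus \<times> A_plus)"
    proof (intro has_sum_cmult_nrm has_sum_sum_nrm)
      fix k assume k: "k \<in> {1..<?J}"
      have Z: "Z k = carlitz_zeta (?s * k)" "Z (?J - k) = carlitz_zeta (?s * (?J - k))"
        using k by (auto simp: Z_def)
      show "((\<lambda>(a, b). 1 / em a ^ (?s * k) * (1 / em b ^ (?s * (?J - k)))) has_sum (Z k * Z (?J - k)))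
          (A_plus \<times> A_plus)"
        unfolding Z using k h s by (intro has_sum_product_nrm has_sum_carlitz_zeta) auto
    qed simp
  next
    fix p :: "'k poly \<times> 'k poly" assume "p \<in> A_plus \<times> A_plus"
    then obtain a b where p: "p = (a, b)" and ab: "a \<in> A_plus" "b \<in> A_plus"
      by blast
    define x where "x = em a ^ ?s"
    define y where "y = em b ^ ?s"
    have xy: "x \<noteq> 0" "y \<noteq> 0"
      using ab zero_notin_A_plus by (auto simp: x_def y_def)
    have fac: "(\<alpha> * em a) ^ ?s = A * (A * x)" "(w * em b) ^ ?s = A * (B * y)"
      "(\<beta> * em b) ^ ?s = B * (B * y)" "(w * em a) ^ ?s = B * (A * x)"
      by (simp_all only: power_mult_distrib A2 B2 W x_def y_def mult_ac)
    \<comment> \<open>Nonvanishing of e(\<alpha> a) excludes A x = B y: the product of A (A x - B y)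
      and \<alpha> a is the product of all \<alpha> a - c w b.\<close>
    have "(\<alpha> * em a) ^ CARD('k) - (w * em b) ^ ?s * (\<alpha> * em a) \<noteq> 0"
      by (rule nonzero_minus_multiples[OF bspec[OF nz(1) ab(1)]])
    then have ne: "A * x \<noteq> B * y"
      unfolding card_power_pred[of "\<alpha> * em a"] fac by auto
    have "1 / A ^ ?J * ?f \<alpha> (a, b) = 1 / (A * x) ^ ?J * (A * x / (A * x - B * y))"
    proof -
      have "em a ^ Suc n = x ^ ?J"
        unfolding n(2) x_def by (rule power_mult)
      moreover have "A * (A * x) / (A * (A * x) - A * (B * y)) = A * x / (A * x - B * y)"
        unfolding right_diff_distrib[symmetric] by (rule mult_divide_mult_cancel_left[OF AB(1)])
      ultimately show ?thesis
        by (simp only: prod.case fac) (simp add: power_mult_distrib)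
    qed
    moreover have "1 / B ^ ?J * ?f \<beta> (b, a) = 1 / (B * y) ^ ?J * (B * y / (B * y - A * x))"
    proof -
      have "em b ^ Suc n = y ^ ?J"
        unfolding n(2) y_def by (rule power_mult)
      moreover have "B * (B * y) / (B * (B * y) - B * (A * x)) = B * y / (B * y - A * x)"
        unfolding right_diff_distrib[symmetric] by (rule mult_divide_mult_cancel_left[OF AB(2)])
      ultimately show ?thesis
        by (simp only: prod.case fac) (simp add: power_mult_distrib)
    qed
    ultimately have "1 / A ^ ?J * ?f \<alpha> (a, b) + 1 / B ^ ?J * ?f \<beta> (b, a)
        = - (\<Sum>k\<in>{1..<?J}. 1 / (A * x) ^ k * (1 / (B * y) ^ (?J - k)))"
      using sum_two_partial_fractions[of "A * x" "B * y" N] AB xy ne by (simp only: mult_eq_0_iff) simp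
    also have "(\<Sum>k\<in>{1..<?J}. 1 / (A * x) ^ k * (1 / (B * y) ^ (?J - k)))
        = (\<Sum>k\<in>{1..<?J}. 1 / (A ^ k * B ^ (?J - k)) * (1 / em a ^ (?s * k) * (1 / em b ^ (?s * (?J - k)))))"
    proof (rule sum.cong[OF refl])
      fix k
      have "em a ^ (?s * k) = x ^ k" "em b ^ (?s * (?J - k)) = y ^ (?J - k)"
        by (simp_all only: x_def y_def power_mult)
      then show "1 / (A * x) ^ k * (1 / (B * y) ^ (?J - k))
          = 1 / (A ^ k * B ^ (?J - k)) * (1 / em a ^ (?s * k) * (1 / em b ^ (?s * (?J - k))))"
        by (simp only: power_mult_distrib times_divide_times_eq mult_1 mult_ac)
    qed
    finally show "- 1 * (\<Sum>k\<in>{1..<?J}. 1 / (A ^ k * B ^ (?J - k))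
          * (case p of (a, b) \<Rightarrow> 1 / em a ^ (?s * k) * (1 / em b ^ (?s * (?J - k)))))
        = 1 / A ^ ?J * ?f \<alpha> p + 1 / B ^ ?J * ?f \<beta> (prod.swap p)"
      by (simp only: p prod.case swap_simp mult_minus1)
  qed
  ultimately have eq: "1 / A ^ ?J * (carlitz_zeta (Suc n) - \<alpha> * monic_sum n \<alpha>)
        + 1 / B ^ ?J * (carlitz_zeta (Suc n) - \<beta> * monic_sum n \<beta>)
      = - 1 * (\<Sum>k\<in>{1..<?J}. 1 / (A ^ k * B ^ (?J - k)) * (Z k * Z (?J - k)))"
    by (rule has_sum_unique_nrm)
  have "(\<Sum>k=0..?J. fps_nth zeta_fps (?s * k) * fps_nth zeta_fps (?s * (?J - k)) * A ^ k * B ^ (?J - k))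
      = (\<Sum>k=0..?J. 1 / (A ^ (?J - k) * B ^ k) * (Z (?J - k) * Z k))"
  proof (rule sum.cong[OF refl])
    fix k
    show "fps_nth zeta_fps (?s * k) * fps_nth zeta_fps (?s * (?J - k)) * A ^ k * B ^ (?J - k)
        = 1 / (A ^ (?J - k) * B ^ k) * (Z (?J - k) * Z k)"
      unfolding zeta using AB by (simp add: power_mult_distrib mult.commute)
  qed
  \<comment> \<open>Division by (A B)^J turned A^k B^(J - k) into the reciprocal of A^(J - k) B^k,
    so the index is reversed to match the double sum.\<close>
  also have "\<dots> = (\<Sum>k=0..?J. 1 / (A ^ k * B ^ (?J - k)) * (Z k * Z (?J - k)))"
    by (rule sum.reindex_bij_witness[where i = "\<lambda>k. ?J - k" and j = "\<lambda>k. ?J - k"]) auto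
  also have "\<dots> = 1 / B ^ ?J * Z ?J + (\<Sum>k\<in>{1..<?J}. 1 / (A ^ k * B ^ (?J - k)) * (Z k * Z (?J - k)))
      + 1 / A ^ ?J * Z ?J"
  proof -
    have "{0..?J} = insert 0 (insert ?J {1..<?J})"
      by auto
    then show ?thesis
      by (simp add: Z_def)
  qed
  also have "\<dots> = 1 / A ^ ?J * (\<alpha> * monic_sum n \<alpha>) + 1 / B ^ ?J * (\<beta> * monic_sum n \<beta>)"
  proof -
    have "Z ?J = carlitz_zeta (Suc n)"
      by (simp only: Z_def n(2) nat.simps if_False)
    with eq show ?thesis
      by (simp add: right_diff_distrib algebra_simps)
  qed
  finally show ?thesis
    by (simp only: A_def B_def)
qed

end

section \<open>Convergence\<close>

context C_infinity
begin

text \<open>Lets closeness at infinity be read as agreement of Laurent coefficients up to index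
  m.\<close>

lemma abs_Kinf_less_iff:
  "abs_Kinf (f :: 'k fls) < 1 / real CARD('k) ^ m \<longleftrightarrow> (\<forall>n\<le>int m. fls_nth f n = 0)"
proof (cases "f = 0")
  case False
  have q: "1 < real CARD('k)"
    using two_le_card_field[where 'k = 'k] by simp
  have "abs_Kinf f < 1 / real CARD('k) ^ m \<longleftrightarrow> real CARD('k) powi (- fls_subdegree f) < real CARD('k) powi (- int m)"
    using False by (simp add: abs_Kinf_def power_int_minus inverse_eq_divide)
  also have "\<dots> \<longleftrightarrow> int m < fls_subdegree f"
    using power_int_strict_increasing[of "- fls_subdegree f" "- int m" "real CARD('k)"]
      power_int_increasing[of "- int m" "- fls_subdegree f" "real CARD('k)"] q by force
  also have "\<dots> \<longleftrightarrow> (\<forall>n\<le>int m. fls_nth f n = 0)"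
  proof
    assume "int m < fls_subdegree f"
    then show "\<forall>n\<le>int m. fls_nth f n = 0"
      by (auto intro: fls_eq0_below_subdegree)
  next
    assume "\<forall>n\<le>int m. fls_nth f n = 0"
    then show "int m < fls_subdegree f"
      using nth_fls_subdegree_nonzero[OF False] by (meson linorder_not_less)
  qed
  finally show ?thesis .
qed (simp add: abs_Kinf_def)

text \<open>The embedded completion is closed: approximations within q^(-m) agree in their
  coefficients up to m, and the Laurent series of these stable coefficients would equal
  \<theta>.\<close>

lemma positive_distance_Kinf:
  assumes "\<theta> \<notin> range (Kinf_embed \<iota>)"
  obtains \<delta> where "\<delta> > 0" "\<And>f. \<delta> \<le> absv (\<theta> - Kinf_embed \<iota> f)"
proof -
  have "\<exists>\<delta>>0. \<forall>f. \<delta> \<le> absv (\<theta> - Kinf_embed \<iota> f)"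
  proof (rule ccontr)
    assume no: "\<not> ?thesis"
    let ?r = "\<lambda>m. 1 / real CARD('k) ^ m"
    have "\<exists>f. absv (\<theta> - Kinf_embed \<iota> f) < ?r m" for m
    proof (rule ccontr)
      assume "\<not> ?thesis"
      then have "\<forall>f. ?r m \<le> absv (\<theta> - Kinf_embed \<iota> f)"
        by (simp add: not_less)
      moreover have "?r m > 0"
        by simp
      ultimately show False
        using no by blast
    qed
    then obtain x where x: "\<And>m. absv (\<theta> - Kinf_embed \<iota> (x m)) < ?r m"
      by metis
    have agree: "fls_nth (x m) n = fls_nth (x m') n" if "m \<le> m'" "n \<le> int m" for m m' n
    proof -
      have "?r m' \<le> ?r m"
        using that(1) two_le_card_field[where 'k = 'k]
        by (intro divide_left_mono power_increasing mult_pos_pos) auto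
      then have "absv (\<theta> - Kinf_embed \<iota> (x m')) < ?r m"
        using x[of m'] by linarith
      then have "absv ((\<theta> - Kinf_embed \<iota> (x m')) - (\<theta> - Kinf_embed \<iota> (x m))) < ?r m"
        using x[of m] nrm_diff_le_max by (metis (no_types, lifting) le_less_trans max_less_iff_conj)
      then have "absv (Kinf_embed \<iota> (x m - x m')) < ?r m"
        by (simp add: Kinf_embed_diff)
      then have "abs_Kinf (x m - x m') < ?r m"
        by (simp only: absv_Kinf_embed)
      then show ?thesis
        using that(2) unfolding abs_Kinf_less_iff by simp
    qed
    \<comment> \<open>Diagonal choice. For negative n the index \<open>nat n\<close> is 0, so the
      pole order is bounded by that of \<open>x 0\<close>.\<close>
    define y where "y = Abs_fls (\<lambda>n. fls_nth (x (nat n)) n)"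
    have y_nth: "fls_nth y n = fls_nth (x (nat n)) n" for n
      unfolding y_def
      by (rule nth_Abs_fls_lower_bound[of "min 0 (fls_subdegree (x 0))"])
         (auto intro: fls_eq0_below_subdegree)
    have "absv (\<theta> - Kinf_embed \<iota> y) < ?r m" for m
    proof -
      have "fls_nth (x m - y) n = 0" if "n \<le> int m" for n
        using agree[of "nat n" m n] that by (cases "n \<ge> 0") (auto simp: y_nth agree[of 0 m n])
      then have "abs_Kinf (x m - y) < ?r m"
        unfolding abs_Kinf_less_iff by blast
      then have "absv (Kinf_embed \<iota> (x m) - Kinf_embed \<iota> y) < ?r m"
        by (simp only: absv_Kinf_embed flip: Kinf_embed_diff)
      then have "absv ((\<theta> - Kinf_embed \<iota> (x m)) + (Kinf_embed \<iota> (x m) - Kinf_embed \<iota> y)) < ?r m"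
        using x[of m] nrm_add_le_max by (metis (no_types, lifting) le_less_trans max_less_iff_conj)
      then show ?thesis
        by simp
    qed
    moreover have "\<exists>m. ?r m < r" if "r > 0" for r
    proof -
      have "1 < real CARD('k)"
        using two_le_card_field[where 'k = 'k] by simp
      then obtain m where "1 / r < real CARD('k) ^ m"
        using real_arch_pow by blast
      then show ?thesis
        using that by (intro exI[of _ m]) (simp add: field_simps)
    qed
    ultimately have "\<not> 0 < absv (\<theta> - Kinf_embed \<iota> y)"
      by (meson less_asym less_trans less_irrefl)
    then have "\<theta> = Kinf_embed \<iota> y"
      by simp
    with assms show False
      by blast
  qed
  with that show ?thesis
    by blast
qed

lemma em_power_int:
  assumes "int n = (int CARD('k) - 1) * int j + (int CARD('k) - 2)"
  shows "em a powi (- (int CARD('k) - 1) * int j - (int CARD('k) - 2)) = 1 / em a ^ n"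
proof -
  have "- (int CARD('k) - 1) * int j - (int CARD('k) - 2) = - int n"
    unfolding assms by (simp add: algebra_simps)
  then show ?thesis
    by (simp add: power_int_minus inverse_eq_divide)
qed

end

context carlitz_period
begin

text \<open>Each finite sum of partial fractions is bounded by its largest term, and the bound
  survives the limit.\<close>

lemma absv_inverse_carlitz_exp_le:
  assumes "e z \<noteq> 0" "\<And>b. \<delta> \<le> absv (z - w * em b)" "\<delta> > 0"
  shows "absv (1 / e z) \<le> 1 / \<delta>"
proof (rule nrm_limit_le[OF inverse_carlitz_exp_limit[OF assms(1)]])
  fix d
  show "absv (\<Sum>b\<in>polys_below d. 1 / (z - w * em b)) \<le> 1 / \<delta>"
  proof (rule nrm_sum_le)
    fix b
    show "absv (1 / (z - w * em b)) \<le> 1 / \<delta>"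
      unfolding nrm_divide nrm_1
      using assms(2)[of b] assms(3) by (intro divide_left_mono mult_pos_pos) linarith+
  qed (use assms(3) in simp)
qed

text \<open>\<alpha> a - w b = w a (\<alpha> / w - b / a), where b / a lies in the completion at
  infinity and \<bar>a\<bar> \<ge> 1. So \<alpha> a keeps a uniform distance from the lattice, 1 /
  e(\<alpha> a) is bounded, and the series is dominated by that of
  \<open>carlitz_zeta n\<close>.\<close>

lemma monic_series_converges:
  assumes \<alpha>: "\<alpha> / w \<notin> range (Kinf_embed \<iota>)" and n: "n > 0"
  shows "\<And>a. a \<in> A_plus \<Longrightarrow> e (\<alpha> * em a) \<noteq> 0"
    and "(\<lambda>a. 1 / em a ^ n / e (\<alpha> * em a)) summable_on A_plus"
proof -
  obtain \<delta> where \<delta>: "\<delta> > 0" "\<And>f. \<delta> \<le> absv (\<alpha> / w - Kinf_embed \<iota> f)"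
    by (rule positive_distance_Kinf[OF \<alpha>]) (rule that; assumption)
  have dist: "absv w * \<delta> \<le> absv (\<alpha> * em a - w * em b)" if "a \<in> A_plus" for a b
  proof -
    have a: "a \<noteq> 0"
      using that zero_notin_A_plus by auto
    have "\<alpha> * em a - w * em b = w * em a * (\<alpha> / w - em b / em a)"
      using a by (simp add: field_simps)
    also have "em b / em a = Kinf_embed \<iota> (A_to_Kinf b / A_to_Kinf a)"
      by (simp add: Kinf_embed_divide A_embed_def)
    finally have "absv (\<alpha> * em a - w * em b)
        = absv w * absv (em a) * absv (\<alpha> / w - Kinf_embed \<iota> (A_to_Kinf b / A_to_Kinf a))"
      by (simp only: nrm_mult)
    moreover have "absv w * 1 * \<delta>
        \<le> absv w * absv (em a) * absv (\<alpha> / w - Kinf_embed \<iota> (A_to_Kinf b / A_to_Kinf a))"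
      using \<delta> one_le_absv_em[OF a] by (intro mult_mono) auto
    ultimately show ?thesis
      by simp
  qed
  have pos: "absv w * \<delta> > 0"
    using \<delta>(1) by simp
  show nz: "e (\<alpha> * em a) \<noteq> 0" if a: "a \<in> A_plus" for a
  proof
    assume "e (\<alpha> * em a) = 0"
    then obtain b where "\<alpha> * em a = w * em b"
      unfolding carlitz_exp_eq_0_iff by blast
    with dist[OF a, of b] pos show False
      by simp
  qed
  have "null_on (\<lambda>a. 1 / em a ^ n / e (\<alpha> * em a)) A_plus"
  proof (rule null_on_mono[OF has_sum_null_on[OF has_sum_carlitz_zeta[OF n]]])
    fix a :: "'k poly" assume a: "a \<in> A_plus"
    have "absv (1 / em a ^ n / e (\<alpha> * em a)) = absv (1 / e (\<alpha> * em a)) * absv (1 / em a ^ n)"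
      by (simp add: nrm_divide nrm_mult mult.commute)
    also have "\<dots> \<le> 1 / (absv w * \<delta>) * absv (1 / em a ^ n)"
      by (rule mult_right_mono[OF absv_inverse_carlitz_exp_le[OF nz[OF a] dist[OF a] pos]]) simp
    finally show "absv (1 / em a ^ n / e (\<alpha> * em a)) \<le> 1 / (absv w * \<delta>) * absv (1 / em a ^ n)" .
  qed
  then show "(\<lambda>a. 1 / em a ^ n / e (\<alpha> * em a)) summable_on A_plus"
    by (rule null_on_summable)
qed

end

text \<open>The identity is conditional on convergence because a term is undefined as soon as
  \<alpha> / \<omega> = b / a with a monic: then e(\<alpha> a) = e(\<omega> b) = 0. The first
  conjunct shows that the condition can be met.\<close>

theorem theorem1p2:
  fixes \<iota> :: "'k::{field,finite} fls alg_closure \<Rightarrow> 'c::{field,complete_space}"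
    and \<alpha> \<beta> \<omega> :: 'c
    and j :: nat
  assumes "odd CARD('k)"
    and "C_infinity \<iota>"
    and "fundamental_period \<iota> \<omega>"
    and "\<alpha> * \<beta> = \<omega>\<^sup>2"
    and "j > 0"
  shows "(\<alpha> / \<omega> \<notin> range (Kinf_embed \<iota>) \<longrightarrow>
            carlitz_series_converges \<iota> j \<alpha> \<and> carlitz_series_converges \<iota> j \<beta>) \<and>
         (carlitz_series_converges \<iota> j \<alpha> \<and> carlitz_series_converges \<iota> j \<beta> \<longrightarrow>
            \<alpha> powi (- int ((CARD('k) - 1) div 2) * (int j - 1) - (int CARD('k) - 2))
              * (\<Sum>\<^sub>\<infinity>a\<in>A_plus. A_embed \<iota> a powi (- (int CARD('k) - 1) * int j - (int CARD('k) - 2))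
                   / carlitz_exp \<iota> (\<alpha> * A_embed \<iota> a))
            + \<beta> powi (- int ((CARD('k) - 1) div 2) * (int j - 1) - (int CARD('k) - 2))
              * (\<Sum>\<^sub>\<infinity>a\<in>A_plus. A_embed \<iota> a powi (- (int CARD('k) - 1) * int j - (int CARD('k) - 2))
                   / carlitz_exp \<iota> (\<beta> * A_embed \<iota> a))
            = (\<Sum>k=0..j+1.
                 K_embed \<iota> (bernoulli_carlitz ((CARD('k) - 1) * k))
                   / A_embed \<iota> (carlitz_factorial ((CARD('k) - 1) * k))
                 * (K_embed \<iota> (bernoulli_carlitz ((CARD('k) - 1) * (j + 1 - k)))
                   / A_embed \<iota> (carlitz_factorial ((CARD('k) - 1) * (j + 1 - k))))
                 * \<alpha> ^ ((CARD('k) - 1) div 2 * k)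
                 * \<beta> ^ ((CARD('k) - 1) div 2 * (j + 1 - k))))"
proof -
  interpret carlitz_period \<iota> \<omega>
    using assms(2,3) by (intro carlitz_period.intro carlitz_period_axioms.intro)
  define h where "h = (CARD('k) - 1) div 2"
  \<comment> \<open>The exponent of 1 / a in the series: (q - 1) j + (q - 2) = (q - 1) (j + 1) -
    1.\<close>
  define n where "n = (CARD('k) - 1) * Suc j - 1"
  have card: "CARD('k) = 2 * h + 1"
    using assms(1) two_le_card_field[where 'k = 'k] by (auto simp: h_def elim!: oddE)
  have h: "h > 0"
    using card two_le_card_field[where 'k = 'k] by simp
  have n0: "n > 0"
    using h by (simp add: n_def card)
  have "int n = (int CARD('k) - 1) * int j + (int CARD('k) - 2)"
    using h by (simp add: n_def card of_nat_diff algebra_simps)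
  note em_powi = em_power_int[OF this]
  have ab: "\<alpha> \<noteq> 0" "\<beta> \<noteq> 0"
    using assms(4) by auto
  have powi: "x powi (- int h * (int j - 1) - (int CARD('k) - 2)) = 1 / (x ^ h) ^ Suc j * x"
    if "x \<noteq> 0" for x :: 'c
  proof -
    \<comment> \<open>Uses q - 2 = 2 h - 1. The extra factor x that this leaves is the one in front
      of \<open>monic_sum\<close> in \<open>reciprocity\<close>.\<close>
    have eq: "- int h * (int j - 1) - (int CARD('k) - 2) = 1 - int (h * Suc j)"
      by (simp add: card algebra_simps)
    have "x powi (1 - int (h * Suc j)) = x powi 1 / x powi (int (h * Suc j))"
      using that by (intro power_int_diff) auto
    then show ?thesis
      unfolding eq by (simp only: power_int_1_right power_int_of_nat power_mult) simp
  qed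
  have conv: "carlitz_series_converges \<iota> j x \<longleftrightarrow>
      (\<forall>a\<in>A_plus. e (x * em a) \<noteq> 0) \<and> (\<lambda>a. 1 / em a ^ n / e (x * em a)) summable_on A_plus" for x
    unfolding carlitz_series_converges_def em_powi ..
  show ?thesis
  proof (intro conjI impI)
    assume \<alpha>: "\<alpha> / \<omega> \<notin> range (Kinf_embed \<iota>)"
    then show "carlitz_series_converges \<iota> j \<alpha>"
      using monic_series_converges[OF _ n0] by (simp only: conv) blast
    \<comment> \<open>The condition passes to \<beta> because the embedded completion is closed
      under inverses.\<close>
    have "\<beta> / \<omega> = inverse (\<alpha> / \<omega>)"
      using ab assms(4) by (simp add: field_simps power2_eq_square)
    then have inv: "\<alpha> / \<omega> = inverse (\<beta> / \<omega>)"
      by simp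
    have "\<beta> / \<omega> \<notin> range (Kinf_embed \<iota>)"
    proof
      assume "\<beta> / \<omega> \<in> range (Kinf_embed \<iota>)"
      then obtain f where f: "\<beta> / \<omega> = Kinf_embed \<iota> f"
        by (rule rangeE)
      have "\<alpha> / \<omega> = Kinf_embed \<iota> (inverse f)"
        unfolding inv f by (rule Kinf_embed_inverse[symmetric])
      with \<alpha> show False
        by blast
    qed
    then show "carlitz_series_converges \<iota> j \<beta>"
      using monic_series_converges[OF _ n0] by (simp only: conv) blast
  next
    assume "carlitz_series_converges \<iota> j \<alpha> \<and> carlitz_series_converges \<iota> j \<beta>"
    then have nz: "\<forall>a\<in>A_plus. e (\<alpha> * em a) \<noteq> 0" "\<forall>a\<in>A_plus. e (\<beta> * em a) \<noteq> 0"
      and summable: "(\<lambda>a. 1 / em a ^ n / e (\<alpha> * em a)) summable_on A_plus"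
        "(\<lambda>a. 1 / em a ^ n / e (\<beta> * em a)) summable_on A_plus"
      unfolding conv by auto
    have "CARD('k) - 1 = 2 * h"
      by (simp add: card)
    note rec = reciprocity[OF this assms(4) nz summable[unfolded n_def], folded n_def]
    have sum: "(\<Sum>\<^sub>\<infinity>a\<in>A_plus. A_embed \<iota> a powi (- (int CARD('k) - 1) * int j - (int CARD('k) - 2))
        / carlitz_exp \<iota> (x * A_embed \<iota> a)) = monic_sum n x" for x
      by (simp only: em_powi monic_sum_def)
    show "\<alpha> powi (- int ((CARD('k) - 1) div 2) * (int j - 1) - (int CARD('k) - 2))
              * (\<Sum>\<^sub>\<infinity>a\<in>A_plus. A_embed \<iota> a powi (- (int CARD('k) - 1) * int j - (int CARD('k) - 2))
                   / carlitz_exp \<iota> (\<alpha> * A_embed \<iota> a))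
            + \<beta> powi (- int ((CARD('k) - 1) div 2) * (int j - 1) - (int CARD('k) - 2))
              * (\<Sum>\<^sub>\<infinity>a\<in>A_plus. A_embed \<iota> a powi (- (int CARD('k) - 1) * int j - (int CARD('k) - 2))
                   / carlitz_exp \<iota> (\<beta> * A_embed \<iota> a))
            = (\<Sum>k=0..j+1.
                 K_embed \<iota> (bernoulli_carlitz ((CARD('k) - 1) * k))
                   / A_embed \<iota> (carlitz_factorial ((CARD('k) - 1) * k))
                 * (K_embed \<iota> (bernoulli_carlitz ((CARD('k) - 1) * (j + 1 - k)))
                   / A_embed \<iota> (carlitz_factorial ((CARD('k) - 1) * (j + 1 - k))))
                 * \<alpha> ^ ((CARD('k) - 1) div 2 * k)
                 * \<beta> ^ ((CARD('k) - 1) div 2 * (j + 1 - k)))"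
      using rec
      by (simp only: sum powi[OF ab(1)] powi[OF ab(2)] bernoulli_carlitz_eq_zeta
          h_def[symmetric] power_mult Suc_eq_plus1[symmetric] mult.assoc)
  qed
qed

end
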